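(* Assume hypotheses (A1)–(A9) listed in the context hold. For $\epsilon>0$ let $(u^\epsilon,m^\epsilon)$ be a solution of the regularized system described in the context, and let $p>d$. Then \begin{align*} \|Du^\epsilon\|_{L^\infty(0,T;L^\infty(\mathbb{T}^d))}\le{}& C+C\|u^\epsilon\|_{L^\infty(0,T;L^\infty(\mathbb{T}^d))}\\ &+C\|g_\epsilon(m^\epsilon)\|_{L^\infty(0,T;L^p(\mathbb{T}^d))}\|Du^\epsilon\|^\mu_{L^\infty(0,T;L^\infty(\mathbb{T}^d))}\big(1+\|u^\epsilon\|_{L^\infty(0,T;L^\infty(\mathbb{T}^d))}\big), \end{align*} where $\mu$ is the exponent in (A7)–(A9) and $C$ is independent of $\epsilon$.
   Context: $\mathbb{T}^d$ is the $d$-dimensional flat torus, $T>0$ fixed. Data: $H:\mathbb{T}^d\times\mathbb{R}^d\to\mathbb{R}$, $g:[0,\infty)\to\mathbb{R}$, $u_T,m_0:\mathbb{T}^d\to\mathbb{R}$. Hypotheses: (A1) $H$ is $C^\infty$; $p\mapsto H(x,p)$ strictly convex; $\lim_{|p|\to\infty}H(x,p)/|p|=+\infty$; $H\ge1$. (A2) $g$ non-negative and increasing; $u_T,m_0\in C^\infty(\mathbb{T}^d)$, $m_0\ge0$, $\int m_0=1$. (A3) With $\hat L(x,p)=D_pH(x,p)\cdot p-H(x,p)$, there are $c,C>0$ with $\hat L\ge cH-C$. (A4) $g(z)=z^\alpha$, $\alpha>0$. (A5) $|D_xH|,|D^2_{xx}H|\le CH+C$, and for every symmetric matrix $M$ and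 $\delta>0$ there is $C_\delta$ with $\operatorname{tr}(D^2_{px}H M)\le\delta\operatorname{tr}(D^2_{pp}HM^2)+C_\delta H$. (A6) $m_0\ge\kappa_0>0$ for a constant $\kappa_0$. (A7) For some $0<\mu<1$ and non-negative constants: $c_1|p|^{2+\mu}+C_1\le H\le c_2|p|^{2+\mu}+C_2$. (A8) $|D_pH(x,p)|^2\le C|p|^\mu H(x,p)+C$. (A9) $|D^2_{xp}H|^2\le CH^{\frac{2+2\mu}{2+\mu}}$ and, for every symmetric $M$, $|D^2_{pp}HM|^2\le CH^{\frac{\mu}{2+\mu}}\operatorname{tr}(D^2_{pp}HMM)$. Regularized system: $\eta_\epsilon$ is a standard symmetric mollifying kernel and $g_\epsilon(m)=\eta_\epsilon*g(\eta_\epsilon*m)$. A solution is a pair of smooth functions $u^\epsilon,m^\epsilon$ on $\mathbb{T}^d\times[0,T]$ with $-u^\epsilon_t+H(x,Du^\epsilon)=\Delta u^\epsilon+g_\epsilon(m^\epsilon)$, $m^\epsilon_t-\operatorname{div}(D_pH(x,Du^\epsilon)m^\epsilon)=\Delta m^\epsilon$, $u^\epsilon(x,T)=u_T(x)$, $m^\epsilon(x,0)=m_0(x)$. *)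

theory Defs
  imports "HOL-Analysis.Analysis"
begin

definition dirderiv :: "'a::euclidean_space \<Rightarrow> ('a \<Rightarrow> real) \<Rightarrow> 'a \<Rightarrow> real" where
  "dirderiv v f z = deriv (\<lambda>h. f (z + h *\<^sub>R v)) 0"

definition iderivs :: "'a::euclidean_space list \<Rightarrow> ('a \<Rightarrow> real) \<Rightarrow> 'a \<Rightarrow> real" where
  "iderivs vs f = foldr dirderiv vs f"

definition smooth_fun :: "('a::euclidean_space \<Rightarrow> real) \<Rightarrow> bool" where
  "smooth_fun f \<longleftrightarrow> (\<forall>vs. set vs \<subseteq> Basis \<longrightarrow>
      continuous_on UNIV (iderivs vs f) \<and>
      (\<forall>b\<in>Basis. \<forall>z. (\<lambda>h. iderivs vs f (z + h *\<^sub>R b)) differentiable (at 0)))"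

text \<open>Functions on the flat torus = functions on R^d that are Z^d-periodic.\<close>
definition periodic_fun :: "(real^'d \<Rightarrow> 'b) \<Rightarrow> bool" where
  "periodic_fun f \<longleftrightarrow> (\<forall>x i. f (x + axis i 1) = f x)"

definition periodic_x :: "((real^'d) \<times> real \<Rightarrow> 'b) \<Rightarrow> bool" where
  "periodic_x f \<longleftrightarrow> (\<forall>t. periodic_fun (\<lambda>x. f (x, t)))"

definition ex :: "'d::finite \<Rightarrow> (real^'d) \<times> (real^'d)" where "ex i = (axis i 1, 0)"
definition ep :: "'d::finite \<Rightarrow> (real^'d) \<times> (real^'d)" where "ep i = (0, axis i 1)"

definition Dx :: "((real^'d) \<times> real \<Rightarrow> real) \<Rightarrow> (real^'d) \<times> real \<Rightarrow> real^'d" where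
  "Dx u z = (\<chi> i. dirderiv (axis i 1, 0) u z)"

definition Dt :: "((real^'d) \<times> real \<Rightarrow> real) \<Rightarrow> (real^'d) \<times> real \<Rightarrow> real" where
  "Dt u z = dirderiv (0, 1) u z"

definition Lap :: "((real^'d::finite) \<times> real \<Rightarrow> real) \<Rightarrow> (real^'d) \<times> real \<Rightarrow> real" where
  "Lap u z = (\<Sum>i\<in>UNIV. dirderiv (axis i 1, 0) (dirderiv (axis i 1, 0) u) z)"

definition Div :: "((real^'d::finite) \<times> real \<Rightarrow> real^'d) \<Rightarrow> (real^'d) \<times> real \<Rightarrow> real" where
  "Div V z = (\<Sum>i\<in>UNIV. dirderiv (axis i 1, 0) (\<lambda>w. V w $ i) z)"

definition Hfun :: "(real^'d \<Rightarrow> real^'d \<Rightarrow> real) \<Rightarrow> (real^'d) \<times> (real^'d) \<Rightarrow> real" where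
  "Hfun H z = H (fst z) (snd z)"

definition DxH :: "(real^'d::finite \<Rightarrow> real^'d \<Rightarrow> real) \<Rightarrow> real^'d \<Rightarrow> real^'d \<Rightarrow> real^'d" where
  "DxH H x p = (\<chi> i. dirderiv (ex i) (Hfun H) (x, p))"

definition DpH :: "(real^'d::finite \<Rightarrow> real^'d \<Rightarrow> real) \<Rightarrow> real^'d \<Rightarrow> real^'d \<Rightarrow> real^'d" where
  "DpH H x p = (\<chi> i. dirderiv (ep i) (Hfun H) (x, p))"

definition DxxH :: "(real^'d::finite \<Rightarrow> real^'d \<Rightarrow> real) \<Rightarrow> real^'d \<Rightarrow> real^'d \<Rightarrow> real^'d^'d" where
  "DxxH H x p = (\<chi> i j. dirderiv (ex i) (dirderiv (ex j) (Hfun H)) (x, p))"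

definition DpxH :: "(real^'d::finite \<Rightarrow> real^'d \<Rightarrow> real) \<Rightarrow> real^'d \<Rightarrow> real^'d \<Rightarrow> real^'d^'d" where
  "DpxH H x p = (\<chi> i j. dirderiv (ep i) (dirderiv (ex j) (Hfun H)) (x, p))"

definition DppH :: "(real^'d::finite \<Rightarrow> real^'d \<Rightarrow> real) \<Rightarrow> real^'d \<Rightarrow> real^'d \<Rightarrow> real^'d^'d" where
  "DppH H x p = (\<chi> i j. dirderiv (ep i) (dirderiv (ep j) (Hfun H)) (x, p))"

definition strictly_convex :: "('a::real_vector \<Rightarrow> real) \<Rightarrow> bool" where
  "strictly_convex f \<longleftrightarrow> (\<forall>x y t. x \<noteq> y \<longrightarrow> 0 < t \<longrightarrow> t < 1 \<longrightarrow>
      f ((1 - t) *\<^sub>R x + t *\<^sub>R y) < (1 - t) * f x + t * f y)"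

definition symmetric_mat :: "real^'d^'d \<Rightarrow> bool" where
  "symmetric_mat M \<longleftrightarrow> transpose M = M"

definition mollifier :: "(real^'d::finite \<Rightarrow> real) \<Rightarrow> bool" where
  "mollifier \<eta> \<longleftrightarrow> smooth_fun \<eta> \<and> (\<forall>y. 0 \<le> \<eta> y) \<and> (\<forall>y. 1 \<le> norm y \<longrightarrow> \<eta> y = 0)
     \<and> (\<eta> has_integral 1) UNIV \<and> (\<forall>y. \<eta> (- y) = \<eta> y)"

definition scaled_kernel :: "(real^'d::finite \<Rightarrow> real) \<Rightarrow> real \<Rightarrow> real^'d \<Rightarrow> real" where
  "scaled_kernel \<eta> \<epsilon> y = (1 / \<epsilon>) ^ CARD('d) * \<eta> ((1 / \<epsilon>) *\<^sub>R y)"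

definition moll :: "(real^'d::finite \<Rightarrow> real) \<Rightarrow> real \<Rightarrow> (real^'d \<Rightarrow> real) \<Rightarrow> real^'d \<Rightarrow> real" where
  "moll \<eta> \<epsilon> f x = integral UNIV (\<lambda>y. scaled_kernel \<eta> \<epsilon> y * f (x - y))"

definition g_eps :: "(real^'d::finite \<Rightarrow> real) \<Rightarrow> real \<Rightarrow> (real \<Rightarrow> real)
    \<Rightarrow> ((real^'d) \<times> real \<Rightarrow> real) \<Rightarrow> (real^'d) \<times> real \<Rightarrow> real" where
  "g_eps \<eta> \<epsilon> g m z = moll \<eta> \<epsilon> (\<lambda>x. g (moll \<eta> \<epsilon> (\<lambda>y. m (y, snd z)) x)) (fst z)"

definition reg_solution ::
  "real \<Rightarrow> (real^'d::finite \<Rightarrow> real^'d \<Rightarrow> real) \<Rightarrow> (real \<Rightarrow> real) \<Rightarrow> (real^'d \<Rightarrow> real)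
   \<Rightarrow> (real^'d \<Rightarrow> real) \<Rightarrow> (real^'d \<Rightarrow> real) \<Rightarrow> real
   \<Rightarrow> ((real^'d) \<times> real \<Rightarrow> real) \<Rightarrow> ((real^'d) \<times> real \<Rightarrow> real) \<Rightarrow> bool" where
  "reg_solution T H g uT m0 \<eta> \<epsilon> u m \<longleftrightarrow>
     smooth_fun u \<and> smooth_fun m \<and> periodic_x u \<and> periodic_x m \<and>
     (\<forall>x. \<forall>t\<in>{0..T}. 0 \<le> m (x, t)) \<and>
     (\<forall>x. \<forall>t\<in>{0..T}.
        - Dt u (x, t) + H x (Dx u (x, t)) = Lap u (x, t) + g_eps \<eta> \<epsilon> g m (x, t)) \<and>
     (\<forall>x. \<forall>t\<in>{0..T}.
        Dt m (x, t) - Div (\<lambda>w. m w *\<^sub>R DpH H (fst w) (Dx u w)) (x, t) = Lap m (x, t)) \<and>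
     (\<forall>x. u (x, T) = uT x) \<and> (\<forall>x. m (x, 0) = m0 x)"

text \<open>L^infinity(0,T; L^infinity(T^d)) norms (sup norms; functions are continuous).\<close>
definition Linf_norm :: "real \<Rightarrow> ((real^'d) \<times> real \<Rightarrow> real) \<Rightarrow> real" where
  "Linf_norm T f = Sup ((\<lambda>z. \<bar>f z\<bar>) ` (UNIV \<times> {0..T}))"

definition Linf_norm_vec :: "real \<Rightarrow> ((real^'d) \<times> real \<Rightarrow> real^'d) \<Rightarrow> real" where
  "Linf_norm_vec T F = Sup ((\<lambda>z. norm (F z)) ` (UNIV \<times> {0..T}))"

text \<open>L^infinity(0,T; L^p(T^d)) norm; the torus is identified with the unit cube.\<close>
definition Linf_Lp_norm :: "real \<Rightarrow> real \<Rightarrow> ((real^'d::finite) \<times> real \<Rightarrow> real) \<Rightarrow> real" where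
  "Linf_Lp_norm T p f = Sup ((\<lambda>t. (integral (cbox 0 One) (\<lambda>x. \<bar>f (x, t)\<bar> powr p)) powr (1 / p)) ` {0..T})"

end

theory Submission
  imports Defs
begin

text \<open>
  Only the equation for \<open>u\<close> is used, through doubling of variables. With \<open>u \<ge> 0\<close> after adding a
  constant, consider a positive maximum of
  \<open>(1 - K |x - y|) u\<^sub>\<delta> (x, t) - u (y, t) - \<phi> (|x - y|)\<close>, where \<open>u\<^sub>\<delta>\<close> is the average of \<open>u\<close> over
  cubes of side \<open>\<delta>\<close>. Convexity of \<open>H\<close> makes \<open>u\<^sub>\<delta>\<close> almost a subsolution whose right-hand side is
  at most \<open>C \<delta>\<close> to the power \<open>- d / p\<close> times the \<open>L\<^sup>p\<close> norm of \<open>f = g_eps\<close>, while \<open>f \<ge> 0\<close> keeps \<open>u\<close> a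
  supersolution. The factor \<open>1 - K |x - y|\<close> turns (A3) into a gain which absorbs the \<open>x\<close>-dependence
  (A5) of \<open>H\<close>, and the concavity of \<open>\<phi>\<close> beats the rest. Hence a slope bound at scale \<open>R\<close> passes to
  scale \<open>R / 2\<close> with an error \<open>O (R powr \<tau>)\<close>, where \<open>\<tau> > 0\<close> because \<open>p > d\<close>. Summing over dyadic scales and
  absorbing a small multiple of \<open>L = \<parallel>Du\<parallel>\<close> gives \<open>L \<le> C (1 + \<parallel>u\<parallel> + \<parallel>f\<parallel>)\<close>, which implies the claim
  since \<open>L powr \<mu> \<ge> 1\<close> unless \<open>L < 1\<close>.
\<close>

subsection \<open>Smooth functions\<close>

lemma has_real_derivative_along_line:
  fixes f :: "'a::real_vector \<Rightarrow> real"
  assumes "((\<lambda>h. f ((z + s *\<^sub>R v) + h *\<^sub>R v)) has_real_derivative D) (at 0)"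
  shows "((\<lambda>h. f (z + h *\<^sub>R v)) has_real_derivative D) (at s)"
proof -
  have "((\<lambda>h. f ((z + s *\<^sub>R v) + (h - s) *\<^sub>R v)) has_real_derivative D) (at s)"
    using DERIV_shift[of "\<lambda>h. f ((z + s *\<^sub>R v) + (h - s) *\<^sub>R v)" D 0 s] assms
    by (simp add: add.commute)
  then show ?thesis by (simp add: algebra_simps)
qed

text \<open>The coordinates in \<open>A\<close> are changed one at a time, each change being
  controlled by the mean value inequality. The base point \<open>w\<close> is allowed to vary near
  \<open>z\<close> because the induction continues from a point that has already been moved.\<close>

lemma continuous_partials_increment:
  fixes f :: "'a::euclidean_space \<Rightarrow> real"
  assumes D: "\<And>b z. b \<in> Basis \<Longrightarrow> ((\<lambda>h. f (z + h *\<^sub>R b)) has_real_derivative g b z) (at 0)"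
    and C: "\<And>b. b \<in> Basis \<Longrightarrow> continuous_on UNIV (g b)"
    and "A \<subseteq> Basis" "0 < e"
  shows "\<exists>d>0. \<forall>w h. norm (w - z) < d \<longrightarrow> norm h < d \<longrightarrow>
    \<bar>f (w + (\<Sum>b\<in>A. (h \<bullet> b) *\<^sub>R b)) - f w - (\<Sum>b\<in>A. (h \<bullet> b) * g b z)\<bar> \<le> e * (\<Sum>b\<in>A. \<bar>h \<bullet> b\<bar>)"
  using finite_subset[OF assms(3) finite_Basis] assms(3)
proof (induction A rule: finite_induct)
  case empty
  then show ?case by (auto intro: exI[of _ 1])
next
  case (insert a A)
  then have a: "a \<in> Basis" by auto
  obtain d1 where d1: "d1 > 0" and IH: "\<And>w h. norm (w - z) < d1 \<Longrightarrow> norm h < d1 \<Longrightarrow>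
    \<bar>f (w + (\<Sum>b\<in>A. (h \<bullet> b) *\<^sub>R b)) - f w - (\<Sum>b\<in>A. (h \<bullet> b) * g b z)\<bar> \<le> e * (\<Sum>b\<in>A. \<bar>h \<bullet> b\<bar>)"
    using insert by blast
  obtain d2 where d2: "d2 > 0" and g: "\<And>y. norm (y - z) < d2 \<Longrightarrow> \<bar>g a y - g a z\<bar> < e"
    using C[OF a] \<open>0 < e\<close> unfolding continuous_on_iff dist_norm real_norm_def by blast
  \<comment> \<open>Halved because the moved base point \<open>w'\<close> is only known to lie
    within \<open>2 * d\<close> of \<open>z\<close>.\<close>
  define d where "d = min d1 d2 / 2"
  have "d > 0" using d1 d2 by (simp add: d_def)
  moreover have "\<bar>f (w + (\<Sum>b\<in>insert a A. (h \<bullet> b) *\<^sub>R b)) - f w - (\<Sum>b\<in>insert a A. (h \<bullet> b) * g b z)\<bar>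
       \<le> e * (\<Sum>b\<in>insert a A. \<bar>h \<bullet> b\<bar>)"
    if w: "norm (w - z) < d" and h: "norm h < d" for w h
  proof -
    define w' where "w' = w + (h \<bullet> a) *\<^sub>R a"
    have ha: "\<bar>h \<bullet> a\<bar> < d" using Basis_le_norm[OF a, of h] h by simp
    have near: "norm (w + s *\<^sub>R a - z) < 2 * d" if "\<bar>s\<bar> \<le> \<bar>h \<bullet> a\<bar>" for s
    proof -
      have "norm (w + s *\<^sub>R a - z) \<le> norm (w - z) + norm (s *\<^sub>R a)"
        using norm_triangle_ineq[of "w - z" "s *\<^sub>R a"] by (simp add: algebra_simps)
      then show ?thesis using w ha that a by simp
    qed
    have 1: "\<bar>f (w' + (\<Sum>b\<in>A. (h \<bullet> b) *\<^sub>R b)) - f w' - (\<Sum>b\<in>A. (h \<bullet> b) * g b z)\<bar> \<le> e * (\<Sum>b\<in>A. \<bar>h \<bullet> b\<bar>)"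
      using near[of "h \<bullet> a"] h \<open>d > 0\<close> by (intro IH) (auto simp: w'_def d_def)
    have "norm ((f (w + (h \<bullet> a) *\<^sub>R a) - (h \<bullet> a) * g a z) - (f (w + 0 *\<^sub>R a) - 0 * g a z)) \<le> e * norm (h \<bullet> a - 0)"
    proof (rule field_differentiable_bound[where S="cball 0 \<bar>h \<bullet> a\<bar>"])
      fix s :: real assume s: "s \<in> cball 0 \<bar>h \<bullet> a\<bar>"
      show "((\<lambda>s. f (w + s *\<^sub>R a) - s * g a z) has_field_derivative (g a (w + s *\<^sub>R a) - g a z))
         (at s within cball 0 \<bar>h \<bullet> a\<bar>)"
      proof (rule has_field_derivative_at_within)
        have "((\<lambda>s. f (w + s *\<^sub>R a)) has_real_derivative g a (w + s *\<^sub>R a)) (at s)"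
          by (rule has_real_derivative_along_line) (rule D[OF a])
        then show "((\<lambda>s. f (w + s *\<^sub>R a) - s * g a z) has_field_derivative (g a (w + s *\<^sub>R a) - g a z)) (at s)"
          by (auto intro!: derivative_eq_intros)
      qed
      show "norm (g a (w + s *\<^sub>R a) - g a z) \<le> e"
        using g[of "w + s *\<^sub>R a"] near[of s] s by (auto simp: d_def)
    qed (auto)
    then have 2: "\<bar>f w' - f w - (h \<bullet> a) * g a z\<bar> \<le> e * \<bar>h \<bullet> a\<bar>"
      by (simp add: w'_def algebra_simps)
    show ?thesis
      using 1 2 insert.hyps by (simp add: w'_def algebra_simps)
  qed
  ultimately show ?case by blast
qed

text \<open>\<open>smooth_fun\<close> speaks of coordinate directions only. Continuity of the
  partial derivatives upgrades them to a total derivative, which gives derivatives along arbitrary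
  lines; the reflected directions used later are not basis vectors.\<close>

lemma has_derivative_of_continuous_partials:
  fixes f :: "'a::euclidean_space \<Rightarrow> real"
  assumes D: "\<And>b z. b \<in> Basis \<Longrightarrow> ((\<lambda>h. f (z + h *\<^sub>R b)) has_real_derivative g b z) (at 0)"
    and C: "\<And>b. b \<in> Basis \<Longrightarrow> continuous_on UNIV (g b)"
  shows "(f has_derivative (\<lambda>h. \<Sum>b\<in>Basis. (h \<bullet> b) * g b z)) (at z)"
  unfolding has_derivative_at_alt
proof (intro conjI allI impI)
  show "bounded_linear (\<lambda>h. \<Sum>b\<in>Basis. (h \<bullet> b) * g b z)"
    by (intro bounded_linear_sum bounded_linear_mult_const bounded_linear_inner_left)
next
  fix e :: real assume "e > 0"
  define e' where "e' = e / DIM('a)"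
  have "e' > 0" using \<open>e > 0\<close> by (simp add: e'_def)
  from continuous_partials_increment[of f g Basis e' z, OF D C order.refl this]
  obtain d where "d > 0" and d: "\<And>w h. norm (w - z) < d \<Longrightarrow> norm h < d \<Longrightarrow>
    \<bar>f (w + (\<Sum>b\<in>Basis. (h \<bullet> b) *\<^sub>R b)) - f w - (\<Sum>b\<in>Basis. (h \<bullet> b) * g b z)\<bar> \<le> e' * (\<Sum>b\<in>Basis. \<bar>h \<bullet> b\<bar>)"
    by blast
  have "norm (f y - f z - (\<Sum>b\<in>Basis. ((y - z) \<bullet> b) * g b z)) \<le> e * norm (y - z)" if "norm (y - z) < d" for y
  proof -
    have "\<bar>f (z + (\<Sum>b\<in>Basis. ((y - z) \<bullet> b) *\<^sub>R b)) - f z - (\<Sum>b\<in>Basis. ((y - z) \<bullet> b) * g b z)\<bar>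
      \<le> e' * (\<Sum>b\<in>Basis. \<bar>(y - z) \<bullet> b\<bar>)"
      using that \<open>d > 0\<close> by (intro d) auto
    also have "(\<Sum>b\<in>Basis. \<bar>(y - z) \<bullet> b\<bar>) \<le> (\<Sum>b\<in>(Basis::'a set). norm (y - z))"
      by (intro sum_mono Basis_le_norm)
    finally have "\<bar>f (z + (\<Sum>b\<in>Basis. ((y - z) \<bullet> b) *\<^sub>R b)) - f z - (\<Sum>b\<in>Basis. ((y - z) \<bullet> b) * g b z)\<bar>
      \<le> e' * (\<Sum>b\<in>(Basis::'a set). norm (y - z))"
      using \<open>e' > 0\<close> by simp
    also have "\<dots> = e * norm (y - z)" by (simp add: e'_def)
    finally have "\<bar>f (z + (\<Sum>b\<in>Basis. ((y - z) \<bullet> b) *\<^sub>R b)) - f z - (\<Sum>b\<in>Basis. ((y - z) \<bullet> b) * g b z)\<bar>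
      \<le> e * norm (y - z)" .
    then show ?thesis by (simp only: euclidean_representation) simp
  qed
  then show "\<exists>d>0. \<forall>y. norm (y - z) < d \<longrightarrow>
      norm (f y - f z - (\<Sum>b\<in>Basis. ((y - z) \<bullet> b) * g b z)) \<le> e * norm (y - z)"
    using \<open>d > 0\<close> by blast
qed

lemma iderivs_Nil [simp]: "iderivs [] f = f"
  by (simp add: iderivs_def)

lemma iderivs_Cons [simp]: "iderivs (v # vs) f = dirderiv v (iderivs vs f)"
  by (simp add: iderivs_def)

lemma iderivs_dirderiv: "iderivs vs (dirderiv b f) = iderivs (vs @ [b]) f"
  by (simp add: iderivs_def)

lemma smooth_fun_dirderiv:
  assumes "smooth_fun f" "b \<in> Basis"
  shows "smooth_fun (dirderiv b f)"
proof -
  have "set (vs @ [b]) \<subseteq> Basis" if "set vs \<subseteq> Basis" for vs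
    using that assms(2) by simp
  then show ?thesis
    using assms(1) unfolding smooth_fun_def iderivs_dirderiv by blast
qed

lemma smooth_fun_continuous: "smooth_fun f \<Longrightarrow> continuous_on S f"
  using continuous_on_subset[OF _ subset_UNIV] unfolding smooth_fun_def by (auto dest!: spec[of _ "[]"])

lemma smooth_fun_has_dirderiv:
  assumes "smooth_fun f" "b \<in> Basis"
  shows "((\<lambda>h. f (z + h *\<^sub>R b)) has_real_derivative dirderiv b f z) (at 0)"
proof -
  have "(\<lambda>h. f (z + h *\<^sub>R b)) differentiable (at 0)"
    using assms unfolding smooth_fun_def by (auto dest!: spec[of _ "[]"])
  then show ?thesis
    unfolding dirderiv_def by (simp add: DERIV_deriv_iff_real_differentiable)
qed

lemma smooth_fun_has_derivative:
  assumes "smooth_fun f"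
  shows "(f has_derivative (\<lambda>h. \<Sum>b\<in>Basis. (h \<bullet> b) * dirderiv b f z)) (at z)"
  by (rule has_derivative_of_continuous_partials)
    (auto intro: smooth_fun_has_dirderiv smooth_fun_continuous smooth_fun_dirderiv assms)

lemma smooth_fun_line_derivative:
  assumes "smooth_fun f"
  shows "((\<lambda>s. f (z + s *\<^sub>R v)) has_real_derivative (\<Sum>b\<in>Basis. (v \<bullet> b) * dirderiv b f (z + s *\<^sub>R v))) (at s)"
proof -
  have "((\<lambda>s. f (z + s *\<^sub>R v)) has_derivative (\<lambda>h. \<Sum>b\<in>Basis. ((h *\<^sub>R v) \<bullet> b) * dirderiv b f (z + s *\<^sub>R v))) (at s)"
    by (rule has_derivative_compose[OF _ smooth_fun_has_derivative[OF assms]])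
      (auto intro!: derivative_eq_intros)
  then show ?thesis
    unfolding has_field_derivative_def
    by (rule has_derivative_eq_rhs) (simp add: fun_eq_iff sum_distrib_left mult_ac)
qed

text \<open>True without differentiability: \<open>deriv\<close> selects a number by the predicate
  \<open>has_real_derivative\<close>, and adding a constant leaves that predicate unchanged.\<close>

lemma dirderiv_add_const: "dirderiv v (\<lambda>z. f z + c) = dirderiv v f"
proof -
  have "((\<lambda>h. g h + c) has_real_derivative D) (at x) \<longleftrightarrow> (g has_real_derivative D) (at x)" for g :: "real \<Rightarrow> real" and D x
    using DERIV_add[of "\<lambda>h. g h + c" D x UNIV "\<lambda>_. -c" 0] DERIV_add[of g D x UNIV "\<lambda>_. c" 0]
    by auto
  then show ?thesis by (auto simp: dirderiv_def deriv_def fun_eq_iff)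
qed

lemma smooth_fun_add_const:
  assumes "smooth_fun f"
  shows "smooth_fun (\<lambda>z. f z + c)"
proof -
  have *: "iderivs vs (\<lambda>z. f z + c) = (\<lambda>z. iderivs vs f z + (if vs = [] then c else 0))" for vs :: "'a list"
    by (induction vs) (auto simp: dirderiv_add_const)
  show ?thesis
    using assms unfolding smooth_fun_def *
    by (auto intro!: continuous_on_add differentiable_add smooth_fun_continuous[OF assms])
qed

section \<open>Basis sums in space, space-time and phase space, written in coordinates\<close>

lemma sum_Basis_vec:
  fixes G :: "real^'d::finite \<Rightarrow> real"
  shows "(\<Sum>b\<in>Basis. G b) = (\<Sum>i\<in>UNIV. G (axis i 1))"
proof -
  have B: "(Basis :: (real^'d) set) = range (\<lambda>i. axis i 1)" by (auto simp: Basis_vec_def)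
  have "inj (\<lambda>i. axis i 1 :: real^'d)" by (auto simp: inj_def axis_eq_axis)
  then show ?thesis unfolding B by (subst sum.reindex) auto
qed

lemma sum_Basis_prod:
  fixes G :: "('a::euclidean_space) \<times> ('b::euclidean_space) \<Rightarrow> real"
  shows "(\<Sum>b\<in>Basis. G b) = (\<Sum>b\<in>Basis. G (b, 0)) + (\<Sum>b\<in>Basis. G (0, b))"
proof -
  have "inj_on (\<lambda>u. (u::'a, 0::'b)) Basis" "inj_on (\<lambda>u. (0::'a, u::'b)) Basis"
    by (auto intro!: inj_onI)
  then show ?thesis
    unfolding Basis_prod_def by (subst sum.union_disjoint) (auto simp: sum.reindex)
qed

lemma sum_Basis_space_time:
  fixes G :: "(real^'d::finite) \<times> real \<Rightarrow> real"
  shows "(\<Sum>b\<in>Basis. ((w, \<tau>) \<bullet> b) * G b) = (\<Sum>i\<in>UNIV. w $ i * G (axis i 1, 0)) + \<tau> * G (0, 1)"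
  by (simp add: sum_Basis_prod sum_Basis_vec inner_axis)

lemma sum_Basis_phase_space:
  fixes G :: "(real^'d::finite) \<times> (real^'d) \<Rightarrow> real"
  shows "(\<Sum>b\<in>Basis. ((w, q) \<bullet> b) * G b) = (\<Sum>i\<in>UNIV. w $ i * G (ex i)) + (\<Sum>i\<in>UNIV. q $ i * G (ep i))"
  by (simp add: sum_Basis_prod sum_Basis_vec inner_axis ex_def ep_def)

lemma axis_space_Basis [simp]: "(axis i 1, 0) \<in> (Basis :: ((real^'d::finite) \<times> real) set)"
  and time_Basis [simp]: "(0, 1) \<in> (Basis :: ((real^'d::finite) \<times> real) set)"
  by (auto simp: Basis_prod_def)

text \<open>If \<open>c\<close> were positive, \<open>g'\<close> would be positive just to the right
  of its zero at 0, and the mean value theorem would give a value above \<open>g 0\<close>.\<close>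

lemma second_derivative_nonpos_at_max:
  fixes g g' :: "real \<Rightarrow> real"
  assumes "0 < e" and g: "\<And>s. \<bar>s\<bar> < e \<Longrightarrow> (g has_real_derivative g' s) (at s)"
    and g': "(g' has_real_derivative c) (at 0)"
    and mx: "\<And>s. \<bar>s\<bar> < e \<Longrightarrow> g s \<le> g 0"
  shows "c \<le> 0"
proof (rule ccontr)
  assume "\<not> c \<le> 0"
  have "g' 0 = 0"
    using DERIV_local_max[of g "g' 0" 0 e] g[of 0] mx \<open>0 < e\<close> by auto
  obtain d where "d > 0" and d: "\<And>h. 0 < h \<Longrightarrow> h < d \<Longrightarrow> g' 0 < g' h"
    using DERIV_pos_inc_right[OF g'] \<open>\<not> c \<le> 0\<close> by auto
  define h where "h = min d e / 2"
  have h: "0 < h" "h < d" "h < e" using \<open>0 < d\<close> \<open>0 < e\<close> by (auto simp: h_def)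
  obtain s where "0 < s" "s < h" "g h - g 0 = (h - 0) * g' s"
    using MVT2[of 0 h g g'] g h by auto
  then have "g h - g 0 > 0" using d[of s] h \<open>g' 0 = 0\<close> by simp
  then show False using mx[of h] h by simp
qed

subsection \<open>Cube averages\<close>

text \<open>The cube has its corner, not its centre, at the spatial point. Rescaling to the unit
  cube removes the volume factor and keeps the formula meaningful for every real
  \<open>\<delta>\<close>; time is not averaged.\<close>

definition cube_avg :: "real \<Rightarrow> ((real^'d::finite) \<times> real \<Rightarrow> real) \<Rightarrow> (real^'d) \<times> real \<Rightarrow> real" where
  "cube_avg \<delta> f z = integral (cbox 0 One) (\<lambda>y. f (z + (\<delta> *\<^sub>R y, 0)))"

lemma cube_avg_integrable:
  fixes f :: "(real^'d::finite) \<times> real \<Rightarrow> real"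
  assumes "continuous_on UNIV f"
  shows "(\<lambda>y. f (z + (\<delta> *\<^sub>R y, 0))) integrable_on cbox 0 (One::real^'d)"
  by (intro integrable_continuous continuous_on_compose2[OF assms] continuous_intros) auto

lemma cube_avg_continuous:
  fixes f :: "(real^'d::finite) \<times> real \<Rightarrow> real"
  assumes "continuous_on UNIV f"
  shows "continuous_on UNIV (cube_avg \<delta> f)"
proof -
  have "continuous_on (UNIV \<times> cbox 0 (One::real^'d)) (\<lambda>(z, y). f (z + (\<delta> *\<^sub>R y, 0)))"
    unfolding split_beta by (intro continuous_on_compose2[OF assms] continuous_intros) auto
  then show ?thesis
    unfolding cube_avg_def by (rule integral_continuous_on_param)
qed

text \<open>Differentiation under the integral sign: \<open>z\<close> enters only by translation, so
  its derivatives pass onto \<open>f\<close>. Hence averaging commutes with all derivatives.\<close>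

lemma cube_avg_has_dirderiv:
  fixes f :: "(real^'d::finite) \<times> real \<Rightarrow> real"
  assumes f: "smooth_fun f" and b: "b \<in> Basis"
  shows "((\<lambda>h. cube_avg \<delta> f (z + h *\<^sub>R b)) has_real_derivative cube_avg \<delta> (dirderiv b f) z) (at 0)"
proof -
  let ?C = "cbox 0 (One::real^'d)"
  have "((\<lambda>h. integral ?C (\<lambda>y. f ((z + h *\<^sub>R b) + (\<delta> *\<^sub>R y, 0)))) has_real_derivative
      integral ?C (\<lambda>y. dirderiv b f ((z + 0 *\<^sub>R b) + (\<delta> *\<^sub>R y, 0)))) (at 0 within UNIV)"
  proof (rule leibniz_rule_field_derivative[where fx="\<lambda>h y. dirderiv b f ((z + h *\<^sub>R b) + (\<delta> *\<^sub>R y, 0))"])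
    fix h :: real and y :: "real^'d"
    have "((\<lambda>h. f ((z + (\<delta> *\<^sub>R y, 0)) + h *\<^sub>R b)) has_real_derivative
        dirderiv b f ((z + (\<delta> *\<^sub>R y, 0)) + h *\<^sub>R b)) (at h)"
      by (rule has_real_derivative_along_line) (rule smooth_fun_has_dirderiv[OF f b])
    then show "((\<lambda>h. f ((z + h *\<^sub>R b) + (\<delta> *\<^sub>R y, 0))) has_real_derivative
        dirderiv b f ((z + h *\<^sub>R b) + (\<delta> *\<^sub>R y, 0))) (at h within UNIV)"
      by (simp add: add_ac)
  next
    fix h :: real
    show "(\<lambda>y. f ((z + h *\<^sub>R b) + (\<delta> *\<^sub>R y, 0))) integrable_on ?C"
      by (rule cube_avg_integrable[OF smooth_fun_continuous[OF f]])
  next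
    show "continuous_on (UNIV \<times> ?C) (\<lambda>(h, y). dirderiv b f ((z + h *\<^sub>R b) + (\<delta> *\<^sub>R y, 0)))"
      unfolding split_beta
      by (intro continuous_on_compose2[OF smooth_fun_continuous[OF smooth_fun_dirderiv[OF f b], of UNIV]] continuous_intros) auto
  qed auto
  then show ?thesis by (simp add: cube_avg_def)
qed

lemma dirderiv_cube_avg:
  "smooth_fun f \<Longrightarrow> b \<in> Basis \<Longrightarrow> dirderiv b (cube_avg \<delta> f) = cube_avg \<delta> (dirderiv b f)"
  unfolding dirderiv_def[of b "cube_avg \<delta> f"] by (intro ext DERIV_imp_deriv cube_avg_has_dirderiv)

lemma smooth_fun_iderivs: "smooth_fun f \<Longrightarrow> set vs \<subseteq> Basis \<Longrightarrow> smooth_fun (iderivs vs f)"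
  by (induction vs) (auto intro: smooth_fun_dirderiv)

lemma smooth_fun_cube_avg:
  assumes f: "smooth_fun f"
  shows "smooth_fun (cube_avg \<delta> f)"
proof -
  have *: "iderivs vs (cube_avg \<delta> f) = cube_avg \<delta> (iderivs vs f)" if "set vs \<subseteq> Basis" for vs
    using that by (induction vs) (auto simp: dirderiv_cube_avg smooth_fun_iderivs f)
  show ?thesis
    unfolding smooth_fun_def
  proof (intro allI impI conjI ballI)
    fix vs :: "((real^'a) \<times> real) list" assume vs: "set vs \<subseteq> Basis"
    note sm = smooth_fun_iderivs[OF f vs]
    show "continuous_on UNIV (iderivs vs (cube_avg \<delta> f))"
      unfolding *[OF vs] by (intro cube_avg_continuous smooth_fun_continuous sm)
    fix b :: "(real^'a) \<times> real" and z assume "b \<in> Basis"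
    then show "(\<lambda>h. iderivs vs (cube_avg \<delta> f) (z + h *\<^sub>R b)) differentiable at 0"
      unfolding *[OF vs] using cube_avg_has_dirderiv[OF sm]
      unfolding real_differentiable_def by blast
  qed
qed

subsection \<open>First and second order conditions at a maximum after doubling\<close>

text \<open>The vectors \<open>w i\<close> are the images of the standard basis under the reflection
  in the hyperplane orthogonal to \<open>e\<close>. They are orthonormal again, and a trace does not
  depend on the orthonormal basis.\<close>

lemma sum_reflection:
  fixes e :: "real^'d::finite"
  assumes "norm e = 1"
  defines "w \<equiv> \<lambda>i. axis i 1 - (2 * e $ i) *\<^sub>R e"
  shows "(\<Sum>i\<in>UNIV. \<Sum>j\<in>UNIV. w i $ j * (\<Sum>k\<in>UNIV. w i $ k * A k j)) = (\<Sum>j\<in>UNIV. A j j)"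
proof -
  have e: "(\<Sum>i\<in>UNIV. e $ i * e $ i) = 1"
    using assms(1) by (simp add: norm_eq_1 inner_vec_def)
  have orth: "(\<Sum>i\<in>UNIV. w i $ j * w i $ k) = (if k = j then 1 else 0)" for j k
  proof -
    have "w i $ j * w i $ k = (if i = j then if k = j then 1 else 0 else 0)
        - (if i = j then 2 * e $ j * e $ k else 0) - (if i = k then 2 * e $ j * e $ k else 0)
        + 4 * e $ j * e $ k * (e $ i * e $ i)" for i
      by (auto simp: w_def axis_def algebra_simps)
    then show ?thesis
      by (simp add: sum.distrib sum_subtractf e flip: sum_distrib_left)
  qed
  have "(\<Sum>i\<in>UNIV. \<Sum>j\<in>UNIV. w i $ j * (\<Sum>k\<in>UNIV. w i $ k * A k j))
      = (\<Sum>j\<in>UNIV. \<Sum>k\<in>UNIV. \<Sum>i\<in>UNIV. w i $ j * w i $ k * A k j)"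
    by (subst sum.swap, rule sum.cong[OF refl], subst sum.swap) (simp add: sum_distrib_left mult.assoc)
  also have "\<dots> = (\<Sum>j\<in>UNIV. \<Sum>k\<in>UNIV. (if k = j then 1 else 0) * A k j)"
    by (simp add: orth flip: sum_distrib_right)
  finally show ?thesis
    by (simp add: if_distrib[of "\<lambda>c. c * _"] cong: if_cong)
qed

text \<open>The second-order condition is taken along the reflection coupling
  \<open>(x + s b\<^sub>i, y + s w\<^sub>i)\<close>, with \<open>w\<^sub>i\<close> the reflection of the basis vector \<open>b\<^sub>i\<close> in the hyperplane orthogonal
  to \<open>x - y\<close>: then \<open>|x - y|\<close> is affine in \<open>s\<close>, and the second derivatives of \<open>u\<close> add up to its Laplacian.\<close>

locale coupling_max =
  fixes v u :: "(real^'d::finite) \<times> real \<Rightarrow> real" and K a S M R T :: real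
    and x y :: "real^'d" and t :: real
  assumes smooth_v: "smooth_fun v" and smooth_u: "smooth_fun u"
    and neq: "x \<noteq> y" and less_R: "norm (x - y) < R"
    and t: "0 \<le> t" "t < T"
    and maximum: "\<And>x' y' t'. norm (x' - y') < R \<Longrightarrow> t' \<in> {0..T} \<Longrightarrow>
      (1 - K * norm (x' - y')) * v (x', t') - u (y', t')
        - (a + S * norm (x' - y') + M / 2 * (norm (x' - y') * (R - norm (x' - y'))))
      \<le> (1 - K * norm (x - y)) * v (x, t) - u (y, t)
        - (a + S * norm (x - y) + M / 2 * (norm (x - y) * (R - norm (x - y))))"
begin

abbreviation r where "r \<equiv> norm (x - y)"

definition e where "e = (1 / r) *\<^sub>R (x - y)"

lemma r_pos: "0 < r" using neq by simp

lemma norm_e: "norm e = 1" using r_pos by (simp add: e_def)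

text \<open>Both points move by the same vector, so \<open>norm (x - y)\<close> and with it the
  barrier stay fixed.\<close>

lemma gradients: "Dx u (y, t) = (1 - K * r) *\<^sub>R Dx v (x, t)"
proof -
  have "(1 - K * r) * dirderiv (axis i 1, 0) v (x, t) - dirderiv (axis i 1, 0) u (y, t) = 0" for i
  proof (rule DERIV_local_max[of _ _ 0 1])
    have "((\<lambda>s. (1 - K * r) * v ((x, t) + s *\<^sub>R (axis i 1, 0)) - u ((y, t) + s *\<^sub>R (axis i 1, 0)))
        has_real_derivative (1 - K * r) * dirderiv (axis i 1, 0) v (x, t) - dirderiv (axis i 1, 0) u (y, t)) (at 0)"
      by (intro DERIV_diff DERIV_cmult smooth_fun_has_dirderiv smooth_u smooth_v axis_space_Basis)
    then show "((\<lambda>s. (1 - K * r) * v (x + s *\<^sub>R axis i 1, t) - u (y + s *\<^sub>R axis i 1, t))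
        has_real_derivative (1 - K * r) * dirderiv (axis i 1, 0) v (x, t) - dirderiv (axis i 1, 0) u (y, t)) (at 0)"
      by simp
    show "\<forall>s. \<bar>0 - s\<bar> < 1 \<longrightarrow> (1 - K * r) * v (x + s *\<^sub>R axis i 1, t) - u (y + s *\<^sub>R axis i 1, t)
        \<le> (1 - K * r) * v (x + 0 *\<^sub>R axis i 1, t) - u (y + 0 *\<^sub>R axis i 1, t)"
    proof (intro allI impI)
      fix s :: real
      show "(1 - K * r) * v (x + s *\<^sub>R axis i 1, t) - u (y + s *\<^sub>R axis i 1, t)
        \<le> (1 - K * r) * v (x + 0 *\<^sub>R axis i 1, t) - u (y + 0 *\<^sub>R axis i 1, t)"
        using maximum[of "x + s *\<^sub>R axis i 1" "y + s *\<^sub>R axis i 1" t] less_R t by simp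
    qed
  qed simp
  then show ?thesis by (simp add: Dx_def vec_eq_iff)
qed

text \<open>Only an inequality, because \<open>t = 0\<close> is allowed: time can be moved forward
  but perhaps not backward.\<close>

lemma time_derivatives: "(1 - K * r) * Dt v (x, t) \<le> Dt u (y, t)"
proof (rule ccontr)
  let ?g = "\<lambda>s. (1 - K * r) * v ((x, t) + s *\<^sub>R (0, 1)) - u ((y, t) + s *\<^sub>R (0, 1))"
  assume "\<not> ?thesis"
  then have pos: "0 < (1 - K * r) * Dt v (x, t) - Dt u (y, t)" by simp
  have "(?g has_real_derivative (1 - K * r) * Dt v (x, t) - Dt u (y, t)) (at 0)"
    unfolding Dt_def by (intro DERIV_diff DERIV_cmult smooth_fun_has_dirderiv smooth_u smooth_v time_Basis)
  from DERIV_pos_inc_right[OF this pos] obtain d where "d > 0"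
    and d: "\<And>h. 0 < h \<Longrightarrow> h < d \<Longrightarrow> ?g 0 < ?g (0 + h)" by blast
  define h where "h = min d (T - t) / 2"
  have "0 < h" "h < d" "t + h \<le> T" using t \<open>d > 0\<close> by (auto simp: h_def min_def field_simps)
  then show False using d[of h] maximum[of x y "t + h"] less_R t by simp
qed

lemma laplacians:
  "(1 - K * r) * Lap v (x, t) - Lap u (y, t) \<le> 4 * K * (e \<bullet> Dx v (x, t)) - 4 * M"
proof -
  define w :: "'d \<Rightarrow> real^'d" where "w i = axis i 1 - (2 * e $ i) *\<^sub>R e" for i
  let ?D = "\<lambda>i f. dirderiv (axis i 1, 0) f"
  have e: "(\<Sum>i\<in>UNIV. e $ i * e $ i) = 1"
    using norm_e by (simp add: norm_eq_1 inner_vec_def)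
  \<comment> \<open>Along the coupling the distance is \<open>r + 2 * s * e $ i\<close>. Its rate
    \<open>2 * e $ i\<close> yields the cross term with coefficient \<open>4 * K\<close>, and its
    square times the second derivative \<open>- M\<close> of the quadratic part of the barrier
    yields \<open>4 * M\<close>.\<close>
  have dir: "(1 - K * r) * ?D i (?D i v) (x, t) - (\<Sum>j\<in>UNIV. w i $ j * (\<Sum>k\<in>UNIV. w i $ k * ?D k (?D j u) (y, t)))
      - 4 * K * e $ i * ?D i v (x, t) + 4 * M * (e $ i * e $ i) \<le> 0" for i
  proof -
    let ?p = "\<lambda>s. r + 2 * s * e $ i"
    let ?zx = "\<lambda>s. (x, t) + s *\<^sub>R (axis i 1, 0)" and ?zy = "\<lambda>s. (y, t) + s *\<^sub>R (w i, 0)"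
    define g where "g s = (1 - K * ?p s) * v (?zx s) - u (?zy s)
      - (a + S * ?p s + M / 2 * (?p s * (R - ?p s)))" for s
    define g' where "g' s = (1 - K * ?p s) * ?D i v (?zx s) - 2 * K * e $ i * v (?zx s)
      - (\<Sum>j\<in>UNIV. w i $ j * ?D j u (?zy s)) - (2 * S * e $ i + M / 2 * (2 * e $ i * (R - 2 * ?p s)))" for s
    \<comment> \<open>Since \<open>\<bar>e $ i\<bar> \<le> 1\<close>, the distance changes by less
      than \<open>2 * \<rho>\<close> and stays strictly between 0 and \<open>R\<close>.\<close>
    define \<rho> where "\<rho> = min r (R - r) / 2"
    have dv: "((\<lambda>s. f (?zx s)) has_real_derivative ?D i f (?zx s)) (at s)" if "smooth_fun f" for f s
      by (rule has_real_derivative_along_line, rule smooth_fun_has_dirderiv[OF that axis_space_Basis])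
    have du: "((\<lambda>s. f (?zy s)) has_real_derivative (\<Sum>j\<in>UNIV. w i $ j * ?D j f (?zy s))) (at s)"
      if "smooth_fun f" for f s
      using smooth_fun_line_derivative[OF that, of "(y, t)" "(w i, 0)" s]
      unfolding sum_Basis_space_time by simp
    note dvD = dv[OF smooth_fun_dirderiv[OF smooth_v axis_space_Basis[of i]]]
    have duD: "((\<lambda>s. ?D j u (?zy s)) has_real_derivative (\<Sum>k\<in>UNIV. w i $ k * ?D k (?D j u) (?zy s))) (at s)" for j s
      by (rule du[OF smooth_fun_dirderiv[OF smooth_u axis_space_Basis[of j]]])
    have "(1 - K * r) * ?D i (?D i v) (x, t) - (\<Sum>j\<in>UNIV. w i $ j * (\<Sum>k\<in>UNIV. w i $ k * ?D k (?D j u) (y, t)))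
      - 4 * K * e $ i * ?D i v (x, t) + 4 * M * (e $ i * e $ i) \<le> 0"
    proof (rule second_derivative_nonpos_at_max)
      show "0 < \<rho>" using r_pos less_R by (simp add: \<rho>_def)
      show "(g has_real_derivative g' s) (at s)" for s
        unfolding g_def g'_def
        by (rule derivative_eq_intros dv[OF smooth_v] du[OF smooth_u] refl)+ (simp add: algebra_simps)
      have "(g' has_real_derivative ((1 - K * ?p 0) * ?D i (?D i v) (?zx 0) - 2 * K * e $ i * ?D i v (?zx 0)
          - 2 * K * e $ i * ?D i v (?zx 0)
          - (\<Sum>j\<in>UNIV. w i $ j * (\<Sum>k\<in>UNIV. w i $ k * ?D k (?D j u) (?zy 0)))
          - (M / 2 * (2 * e $ i * (- 4 * e $ i))))) (at 0)"
        unfolding g'_def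
        by (rule derivative_eq_intros dv[OF smooth_v] dvD duD refl)+
          (simp add: algebra_simps)
      then show "(g' has_real_derivative ((1 - K * r) * ?D i (?D i v) (x, t)
          - (\<Sum>j\<in>UNIV. w i $ j * (\<Sum>k\<in>UNIV. w i $ k * ?D k (?D j u) (y, t)))
          - 4 * K * e $ i * ?D i v (x, t) + 4 * M * (e $ i * e $ i))) (at 0)"
        by (rule DERIV_cong) (simp add: algebra_simps)
      show "g s \<le> g 0" if s: "\<bar>s\<bar> < \<rho>" for s
      proof -
        have "\<bar>e $ i\<bar> \<le> 1" using component_le_norm_cart[of e i] norm_e by simp
        then have "\<bar>s * e $ i\<bar> < \<rho>"
          using s mult_mono[of "\<bar>s\<bar>" "\<bar>s\<bar>" "\<bar>e $ i\<bar>" 1] by (simp add: abs_mult)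
        then have p: "0 < ?p s" "?p s < R" by (auto simp: \<rho>_def min_def split: if_splits)
        \<comment> \<open>The reflection keeps the difference of the two points parallel to
          \<open>e\<close>, so no second-order term of the norm appears.\<close>
        have "(x + s *\<^sub>R axis i 1) - (y + s *\<^sub>R w i) = ?p s *\<^sub>R e"
          using r_pos by (simp add: w_def algebra_simps) (simp add: e_def)
        then have "norm ((x + s *\<^sub>R axis i 1) - (y + s *\<^sub>R w i)) = ?p s"
          using p norm_e by simp
        then show ?thesis
          using maximum[of "x + s *\<^sub>R axis i 1" "y + s *\<^sub>R w i" t] p t by (simp add: g_def)
      qed
    qed
    then show ?thesis .
  qed
  have "(\<Sum>i\<in>UNIV. (1 - K * r) * ?D i (?D i v) (x, t)
      - (\<Sum>j\<in>UNIV. w i $ j * (\<Sum>k\<in>UNIV. w i $ k * ?D k (?D j u) (y, t)))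
      - 4 * K * e $ i * ?D i v (x, t) + 4 * M * (e $ i * e $ i)) \<le> 0"
    by (intro sum_nonpos dir)
  then have "(1 - K * r) * Lap v (x, t)
      - (\<Sum>i\<in>UNIV. \<Sum>j\<in>UNIV. w i $ j * (\<Sum>k\<in>UNIV. w i $ k * ?D k (?D j u) (y, t)))
      - 4 * K * (e \<bullet> Dx v (x, t)) + 4 * M * (\<Sum>i\<in>UNIV. e $ i * e $ i) \<le> 0"
    by (simp add: sum.distrib sum_subtractf sum_distrib_left Lap_def inner_vec_def Dx_def mult_ac)
  moreover have "(\<Sum>i\<in>UNIV. \<Sum>j\<in>UNIV. w i $ j * (\<Sum>k\<in>UNIV. w i $ k * ?D k (?D j u) (y, t))) = Lap u (y, t)"
    unfolding w_def Lap_def by (rule sum_reflection[OF norm_e])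
  ultimately show ?thesis by (simp add: e)
qed

end

subsection \<open>The Hamiltonian\<close>

lemma Hfun_x_line:
  assumes "smooth_fun (Hfun H)"
  shows "((\<lambda>s. H (x + s *\<^sub>R w) q) has_real_derivative DxH H (x + s *\<^sub>R w) q \<bullet> w) (at s)"
  using smooth_fun_line_derivative[OF assms, of "(x, q)" "(w, 0)" s]
  unfolding sum_Basis_phase_space by (simp add: Hfun_def DxH_def inner_vec_def mult.commute)

lemma Hfun_p_line:
  assumes "smooth_fun (Hfun H)"
  shows "((\<lambda>s. H x (q + s *\<^sub>R w)) has_real_derivative DpH H x (q + s *\<^sub>R w) \<bullet> w) (at s)"
  using smooth_fun_line_derivative[OF assms, of "(x, q)" "(0, w)" s]
  unfolding sum_Basis_phase_space by (simp add: Hfun_def DpH_def inner_vec_def mult.commute)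

text \<open>By \<open>1 \<le> H\<close> the derivative bound is at most \<open>2 * C * H\<close>, so
  along a segment \<open>H\<close> decays at most exponentially with rate
  \<open>2 * C\<close>.\<close>

lemma Hfun_x_gronwall:
  assumes smooth: "smooth_fun (Hfun H)" and "\<And>x q. 1 \<le> H x q" "0 \<le> C"
    and D: "\<And>x q. norm (DxH H x q) \<le> C * H x q + C"
  shows "exp (- (2 * C * norm (x' - x))) * H x q \<le> H x' q"
proof -
  define w where "w = x' - x"
  let ?k = "\<lambda>s. exp (2 * C * norm w * s) * H (x + s *\<^sub>R w) q"
  have "?k 0 \<le> ?k 1"
  proof (rule DERIV_nonneg_imp_nondecreasing[where f="?k"])
    fix s :: real
    let ?D = "exp (2 * C * norm w * s) * (DxH H (x + s *\<^sub>R w) q \<bullet> w + 2 * C * norm w * H (x + s *\<^sub>R w) q)"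
    have "(?k has_real_derivative ?D) (at s)"
      by (rule derivative_eq_intros Hfun_x_line[OF smooth] refl)+ (simp add: algebra_simps)
    moreover have "- (DxH H (x + s *\<^sub>R w) q \<bullet> w) \<le> 2 * C * norm w * H (x + s *\<^sub>R w) q"
    proof -
      have "- (DxH H (x + s *\<^sub>R w) q \<bullet> w) \<le> norm (DxH H (x + s *\<^sub>R w) q) * norm w"
        using Cauchy_Schwarz_ineq2[of "DxH H (x + s *\<^sub>R w) q" w] by simp
      also have "\<dots> \<le> (C * H (x + s *\<^sub>R w) q + C) * norm w"
        by (intro mult_right_mono D) simp
      also have "\<dots> \<le> (C * H (x + s *\<^sub>R w) q + C * H (x + s *\<^sub>R w) q) * norm w"
        using assms by (intro mult_right_mono add_left_mono) (auto simp: mult_le_cancel_left1)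
      finally show ?thesis by (simp add: algebra_simps)
    qed
    ultimately show "\<exists>D. (?k has_real_derivative D) (at s) \<and> 0 \<le> D"
      by (intro exI[of _ ?D]) simp
  qed simp
  then show ?thesis by (simp add: w_def exp_minus field_simps)
qed

text \<open>The hypothesis on \<open>DpH H x q \<bullet> q - H x q\<close> says exactly that
  \<open>\<sigma> powr (- (1 + c)) * (H x (\<sigma> *\<^sub>R q) - C')\<close> is nondecreasing in
  \<open>\<sigma>\<close>, with \<open>C'\<close> chosen so that \<open>(1 + c) * C' = C\<close>.
  Values at \<open>s\<close> and at 1 are compared.\<close>

lemma Hfun_p_scaling:
  assumes smooth: "smooth_fun (Hfun H)" and "0 < c" "0 \<le> C"
    and L: "\<And>x q. c * H x q - C \<le> DpH H x q \<bullet> q - H x q"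
    and s: "0 < s" "s \<le> 1"
  shows "H x (s *\<^sub>R q) \<le> s powr (1 + c) * H x q + C"
proof -
  define C' where "C' = C / (1 + c)"
  have C': "0 \<le> C'" "C' \<le> C" "(1 + c) * C' = C"
    using \<open>0 < c\<close> \<open>0 \<le> C\<close> by (auto simp: C'_def divide_le_eq mult_le_cancel_left1 field_simps)
  let ?k = "\<lambda>\<sigma>. \<sigma> powr (- (1 + c)) * (H x (0 + \<sigma> *\<^sub>R q) - C')"
  have "?k s \<le> ?k 1"
  proof (rule DERIV_nonneg_imp_nondecreasing[where f="?k"])
    fix \<sigma> assume "s \<le> \<sigma>" "\<sigma> \<le> 1"
    with s have \<sigma>: "0 < \<sigma>" by simp
    let ?D = "\<sigma> powr (- (2 + c)) * (DpH H x (\<sigma> *\<^sub>R q) \<bullet> (\<sigma> *\<^sub>R q) - (1 + c) * (H x (\<sigma> *\<^sub>R q) - C'))"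
    have "(?k has_real_derivative ?D) (at \<sigma>)"
    proof (rule DERIV_cong)
      show "(?k has_real_derivative (- (1 + c)) * \<sigma> powr (- (1 + c) - 1) * (H x (0 + \<sigma> *\<^sub>R q) - C')
          + (DpH H x (0 + \<sigma> *\<^sub>R q) \<bullet> q - 0) * \<sigma> powr (- (1 + c))) (at \<sigma>)"
        by (intro DERIV_mult DERIV_diff DERIV_const Hfun_p_line[OF smooth] has_real_derivative_powr \<sigma>)
      have "\<sigma> powr (- (1 + c)) = \<sigma> * \<sigma> powr (- (2 + c))"
        using \<sigma> powr_add[of \<sigma> 1 "- (2 + c)"] by simp
      moreover have "- (1 + c) - 1 = - (2 + c)" by simp
      ultimately show "(- (1 + c)) * \<sigma> powr (- (1 + c) - 1) * (H x (0 + \<sigma> *\<^sub>R q) - C')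
          + (DpH H x (0 + \<sigma> *\<^sub>R q) \<bullet> q - 0) * \<sigma> powr (- (1 + c)) = ?D"
        by (simp only: ) (simp add: algebra_simps)
    qed
    moreover have "0 \<le> ?D"
      using L[of x "\<sigma> *\<^sub>R q"] C' by (intro mult_nonneg_nonneg) (auto simp: algebra_simps)
    ultimately show "\<exists>D. (?k has_real_derivative D) (at \<sigma>) \<and> 0 \<le> D" by blast
  qed (use s in simp)
  then have "s powr (1 + c) * ?k s \<le> s powr (1 + c) * ?k 1"
    by (rule mult_left_mono) simp
  then have "H x (s *\<^sub>R q) - C' \<le> s powr (1 + c) * (H x q - C')"
  proof -
    have "s powr (1 + c) * s powr (- (1 + c)) = 1" using s by (simp flip: powr_add)
    then have "s powr (1 + c) * ?k s = H x (s *\<^sub>R q) - C'"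
      by (simp only: mult.assoc[symmetric] mult_1 add_0)
    moreover have "s powr (1 + c) * ?k 1 = s powr (1 + c) * (H x q - C')" by simp
    ultimately show ?thesis using \<open>s powr (1 + c) * ?k s \<le> s powr (1 + c) * ?k 1\<close> by linarith
  qed
  moreover have "0 \<le> s powr (1 + c) * C'" using C' by simp
  ultimately show ?thesis using C'(2) unfolding right_diff_distrib by linarith
qed

text \<open>A tangent above the value at \<open>p\<close> would lift \<open>H\<close> above its
  chord just after leaving \<open>q\<close>.\<close>

lemma Hfun_p_tangent:
  assumes smooth: "smooth_fun (Hfun H)" and "strictly_convex (H x)"
  shows "H x q + DpH H x q \<bullet> (p - q) \<le> H x p"
proof (cases "p = q")
  case False
  show ?thesis
  proof (rule ccontr)
    assume "\<not> ?thesis"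
    then have pos: "0 < DpH H x q \<bullet> (p - q) - (H x p - H x q)" by simp
    let ?g = "\<lambda>s. H x (q + s *\<^sub>R (p - q)) - s * (H x p - H x q)"
    have "(?g has_real_derivative DpH H x q \<bullet> (p - q) - (H x p - H x q)) (at 0)"
      using Hfun_p_line[OF smooth, of x q "p - q" 0]
      by (auto intro!: derivative_eq_intros)
    from DERIV_pos_inc_right[OF this pos] obtain d where "d > 0"
      and d: "\<And>h. 0 < h \<Longrightarrow> h < d \<Longrightarrow> ?g 0 < ?g (0 + h)" by blast
    define h where "h = min d 1 / 2"
    have h: "0 < h" "h < d" "h < 1" using \<open>d > 0\<close> by (auto simp: h_def)
    have "H x ((1 - h) *\<^sub>R q + h *\<^sub>R p) < (1 - h) * H x q + h * H x p"
      using assms(2) False h unfolding strictly_convex_def by metis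
    moreover have "q + h *\<^sub>R (p - q) = (1 - h) *\<^sub>R q + h *\<^sub>R p"
      by (simp add: algebra_simps)
    ultimately show False using d[OF h(1,2)] by (simp add: algebra_simps)
  qed
qed simp

text \<open>The tangent inequality at the mean of \<open>P\<close> is integrated; its linear part
  has integral zero because the unit cube has volume 1.\<close>

lemma Hfun_p_jensen:
  fixes P :: "real^'d::finite \<Rightarrow> real^'d"
  assumes smooth: "smooth_fun (Hfun H)" and conv: "strictly_convex (H x)"
    and P: "continuous_on (cbox 0 One) P"
  shows "H x (integral (cbox 0 One) P) \<le> integral (cbox 0 One) (\<lambda>y. H x (P y))"
proof -
  let ?C = "cbox 0 (One::real^'d)"
  let ?q = "integral ?C P"
  have H: "continuous_on UNIV (Hfun H)" by (rule smooth_fun_continuous[OF smooth])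
  have "((\<lambda>y. H x ?q + DpH H x ?q \<bullet> (P y - ?q)) has_integral H x ?q + DpH H x ?q \<bullet> (?q - ?q)) ?C"
  proof -
    have "(P has_integral ?q) ?C" by (intro integrable_integral integrable_continuous P)
    from has_integral_linear[OF has_integral_diff[OF this has_integral_const] bounded_linear_inner_right]
    have "((\<lambda>y. DpH H x ?q \<bullet> (P y - ?q)) has_integral DpH H x ?q \<bullet> (?q - ?q)) ?C"
      unfolding o_def by (metis content_unit scaleR_one)
    from has_integral_add[OF has_integral_const[of "H x ?q" 0 One] this]
    show ?thesis by simp
  qed
  moreover have "((\<lambda>y. H x (P y)) has_integral integral ?C (\<lambda>y. H x (P y))) ?C"
  proof (intro integrable_integral integrable_continuous)
    have "continuous_on ?C (\<lambda>y. Hfun H (x, P y))"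
      by (intro continuous_on_compose2[OF H] continuous_intros P) auto
    then show "continuous_on ?C (\<lambda>y. H x (P y))" by (simp add: Hfun_def)
  qed
  ultimately have "H x ?q + DpH H x ?q \<bullet> (?q - ?q) \<le> integral ?C (\<lambda>y. H x (P y))"
    by (rule has_integral_le) (rule Hfun_p_tangent[OF smooth conv])
  then show ?thesis by simp
qed

subsection \<open>Periodic functions and averages over small cubes\<close>

lemma periodic_fun_of_int:
  assumes "periodic_fun f"
  shows "f (x + of_int n *\<^sub>R axis i 1) = f x"
proof (induction n arbitrary: x rule: int_induct[where k=0])
  case (step1 n)
  have "f (x + of_int (n + 1) *\<^sub>R axis i 1) = f ((x + of_int n *\<^sub>R axis i 1) + axis i 1)"
    by (simp add: algebra_simps)
  then show ?case using step1 assms by (simp add: periodic_fun_def)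
next
  case (step2 n)
  have "f (x + of_int (n - 1) *\<^sub>R axis i 1) = f ((x + of_int (n - 1) *\<^sub>R axis i 1) + axis i 1)"
    using assms by (simp add: periodic_fun_def)
  also have "\<dots> = f (x + of_int n *\<^sub>R axis i 1)"
    by (simp add: algebra_simps)
  finally show ?case using step2 by simp
qed simp

lemma periodic_fun_integer_vector:
  fixes f :: "real^'d::finite \<Rightarrow> 'b"
  assumes f: "periodic_fun f" and k: "\<And>i. k $ i \<in> \<int>"
  shows "f (x + k) = f x"
proof -
  have "f (x + (\<Sum>i\<in>A. k $ i *\<^sub>R axis i 1)) = f x" if "finite A" for A
    using that
  proof (induction A rule: finite_induct)
    case (insert i A)
    obtain n where "k $ i = of_int n" using k Ints_cases by blast
    then show ?case
      using periodic_fun_of_int[OF f, of "x + (\<Sum>i\<in>A. k $ i *\<^sub>R axis i 1)" n i] insert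
      by (simp add: add_ac)
  qed simp
  from this[of UNIV] show ?thesis
    by (simp add: basis_expansion[where x=k] flip: scalar_mult_eq_scaleR)
qed

definition floor_vec :: "real^'d \<Rightarrow> real^'d" where
  "floor_vec x = (\<chi> i. of_int \<lfloor>x $ i\<rfloor>)"

lemma sum_Basis_nth [simp]: "(\<Sum>b\<in>Basis. b $ i) = (1::real)" for i :: "'d::finite"
  by (simp add: sum_Basis_vec axis_def)

lemma mem_cbox_One: "(y :: real^'d::finite) \<in> cbox 0 One \<longleftrightarrow> (\<forall>i. 0 \<le> y $ i \<and> y $ i \<le> 1)"
  by (simp add: mem_box_cart)

lemma floor_vec_integer: "floor_vec x $ i \<in> \<int>"
  by (simp add: floor_vec_def)

lemma diff_floor_vec_in_cube: "x - floor_vec x \<in> cbox 0 (One::real^'d::finite)"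
  unfolding mem_cbox_One floor_vec_def
  by (auto simp: le_diff_eq diff_le_eq) (metis add.commute less_eq_real_def real_of_int_floor_add_one_gt)

lemma periodic_fun_floor_vec:
  assumes "periodic_fun f"
  shows "f (x - floor_vec z) = f x"
  using periodic_fun_integer_vector[OF assms floor_vec_integer[of z], of "x - floor_vec z"] by simp

lemma norm_le_CARD_cube: "y \<in> cbox 0 (One::real^'d::finite) \<Longrightarrow> norm y \<le> real CARD('d)"
proof -
  assume "y \<in> cbox 0 One"
  then have "(\<Sum>i\<in>UNIV. \<bar>y $ i\<bar>) \<le> (\<Sum>i\<in>(UNIV::'d set). 1)"
    unfolding mem_cbox_One by (intro sum_mono) simp
  then show ?thesis using norm_le_l1_cart[of y] by simp
qed

text \<open>The small cube lies in the cube of side 2 with corner 0, which is covered by the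
  \<open>2 ^ CARD('d)\<close> unit cubes with corners in {0,1}^d. Periodicity gives \<open>h\<close>
  the same integral over each of them.\<close>

lemma integral_periodic_sub_cube:
  fixes h :: "real^'d::finite \<Rightarrow> real"
  assumes cont: "continuous_on UNIV h" and nn: "\<And>x. 0 \<le> h x" and per: "periodic_fun h"
    and x: "x \<in> cbox 0 One" and "0 \<le> \<delta>" "\<delta> \<le> 1"
  shows "integral (cbox x (x + \<delta> *\<^sub>R One)) h \<le> 2 ^ CARD('d) * integral (cbox 0 One) h"
proof -
  define k :: "('d \<Rightarrow> bool) \<Rightarrow> real^'d" where "k b = (\<chi> i. if b i then 1 else 0)" for b
  let ?I = "integral (cbox 0 One) h"
  have int: "(h has_integral integral (cbox a b) h) (cbox a b)" for a b
    by (intro integrable_integral integrable_continuous continuous_on_subset[OF cont]) auto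
  have "(h has_integral ?I) (cbox (k b) (One + k b))" for b
  proof -
    have "h \<circ> (+) (k b) = h"
      using periodic_fun_integer_vector[OF per, of "k b"] by (auto simp: k_def add.commute)
    then show ?thesis
      using has_integral_shift_cbox_iff[of h "k b" ?I 0 One] int[of 0 One] by simp
  qed
  then have "((\<lambda>y. if y \<in> cbox (k b) (One + k b) then h y else 0) has_integral ?I) UNIV" for b
    by (simp only: has_integral_restrict_UNIV)
  then have sum: "((\<lambda>y. \<Sum>b\<in>UNIV. if y \<in> cbox (k b) (One + k b) then h y else 0) has_integral (\<Sum>b\<in>(UNIV::('d \<Rightarrow> bool) set). ?I)) UNIV"
    by (intro has_integral_sum) auto
  have "((\<lambda>y. if y \<in> cbox x (x + \<delta> *\<^sub>R One) then h y else 0) has_integral integral (cbox x (x + \<delta> *\<^sub>R One)) h) UNIV"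
    using int by (simp only: has_integral_restrict_UNIV)
  then have "integral (cbox x (x + \<delta> *\<^sub>R One)) h \<le> (\<Sum>b\<in>(UNIV::('d \<Rightarrow> bool) set). ?I)"
  proof (rule has_integral_le[OF _ sum])
    fix y
    show "(if y \<in> cbox x (x + \<delta> *\<^sub>R One) then h y else 0)
        \<le> (\<Sum>b\<in>UNIV. if y \<in> cbox (k b) (One + k b) then h y else 0)"
    proof (cases "y \<in> cbox x (x + \<delta> *\<^sub>R One)")
      case True
      \<comment> \<open>The covering unit cube that contains \<open>y\<close> is found coordinate by
        coordinate.\<close>
      define b where "b i \<longleftrightarrow> 1 < y $ i" for i
      have "0 \<le> y $ i \<and> y $ i \<le> 2" for i
      proof -
        have "0 \<le> x $ i" "x $ i \<le> 1" "x $ i \<le> y $ i" "y $ i \<le> x $ i + \<delta>"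
          using True x by (simp_all add: mem_box_cart)
        then show ?thesis using \<open>\<delta> \<le> 1\<close> by simp
      qed
      then have "y \<in> cbox (k b) (One + k b)"
        by (auto simp: mem_box_cart k_def b_def)
      then have "h y = (if y \<in> cbox (k b) (One + k b) then h y else 0)" by simp
      also have "\<dots> \<le> (\<Sum>b\<in>UNIV. if y \<in> cbox (k b) (One + k b) then h y else 0)"
        by (rule member_le_sum) (auto simp: nn)
      finally show ?thesis using True by simp
    qed (auto intro!: sum_nonneg nn)
  qed
  then show ?thesis by (simp add: card_fun)
qed

text \<open>Young's inequality for \<open>y / a\<close> and 1. Integrated with a well chosen
  \<open>a\<close>, this pointwise bound does the work of Hoelder's inequality.\<close>

lemma scaled_Young:
  fixes p :: real
  assumes "1 < p" "0 < a" "0 \<le> y"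
  shows "y \<le> a powr (1 - p) / p * y powr p + (1 - 1 / p) * a"
proof -
  define q where "q = p / (p - 1)"
  have q: "1 < q" "1 / p + 1 / q = 1" using \<open>1 < p\<close> by (auto simp: q_def field_simps)
  have "y / a * 1 \<le> (y / a) powr p / p + 1 powr q / q"
    using assms q by (intro Youngs_inequality) auto
  then have "a * (y / a) \<le> a * ((y / a) powr p / p + 1 / q)"
    using \<open>0 < a\<close> by (intro mult_left_mono) auto
  moreover have "a * (y / a) powr p = a powr (1 - p) * y powr p"
    using assms by (simp add: powr_divide powr_diff)
  moreover have "1 / q = 1 - 1 / p" using q(2) by simp
  ultimately show ?thesis using \<open>0 < a\<close> by (simp add: algebra_simps)
qed

text \<open>A small cube of side \<open>\<delta>\<close> carries at most a fixed multiple of the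
  full integral of \<open>h powr p\<close>, and rescaling it to the unit cube costs a factor
  \<open>\<delta> ^ CARD('d)\<close> in the denominator.\<close>

lemma cube_average_le_Lp:
  fixes h :: "real^'d::finite \<Rightarrow> real"
  assumes cont: "continuous_on UNIV h" and nn: "\<And>x. 0 \<le> h x" and per: "periodic_fun h"
    and p: "1 < p" and \<delta>: "0 < \<delta>" "\<delta> \<le> 1" and B: "0 < B"
    and Lp: "integral (cbox 0 One) (\<lambda>x. h x powr p) \<le> B powr p"
  shows "integral (cbox 0 One) (\<lambda>y. h (x + \<delta> *\<^sub>R y)) \<le> 2 ^ CARD('d) * B * \<delta> powr (- (CARD('d) / p))"
proof -
  let ?n = "CARD('d)" let ?C = "cbox 0 (One::real^'d)"
  define x0 where "x0 = x - floor_vec x"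
  have x0: "x0 \<in> ?C" unfolding x0_def by (rule diff_floor_vec_in_cube)
  have hx0: "h (x + \<delta> *\<^sub>R y) = h (x0 + \<delta> *\<^sub>R y)" for y
    using periodic_fun_floor_vec[OF per, of "x + \<delta> *\<^sub>R y" x] by (simp add: x0_def algebra_simps)
  let ?h = "\<lambda>x. h x powr p"
  have cont': "continuous_on UNIV ?h"
    using nn p by (intro continuous_on_powr' cont continuous_on_const) (auto intro: nn)
  have per': "periodic_fun ?h" using per by (simp add: periodic_fun_def)
  let ?J = "integral (cbox x0 (x0 + \<delta> *\<^sub>R One)) ?h"
  have "(?h has_integral ?J) (cbox x0 (x0 + \<delta> *\<^sub>R One))"
    by (intro integrable_integral integrable_continuous continuous_on_subset[OF cont']) auto
  from has_integral_affinity'[OF this \<delta>(1), of x0]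
  have J: "((\<lambda>y. ?h (x0 + \<delta> *\<^sub>R y)) has_integral ?J / \<delta> ^ ?n) ?C"
    using \<delta> by (simp add: add.commute divide_inverse mult.commute)
  have "?J \<le> 2 ^ ?n * integral ?C ?h"
    by (rule integral_periodic_sub_cube[OF cont' _ per' x0]) (use \<delta> in auto)
  also have "\<dots> \<le> 2 ^ ?n * B powr p" using Lp by simp
  finally have J_le: "?J \<le> 2 ^ ?n * B powr p" .
  \<comment> \<open>The size expected of the average. With this value both terms of
    \<open>scaled_Young\<close> become multiples of \<open>a\<close>, with weights
    \<open>1 / p\<close> and \<open>1 - 1 / p\<close>.\<close>
  define a where "a = B * \<delta> powr (- (?n / p))"
  have a: "0 < a" using B \<delta> by (simp add: a_def)
  have ap: "a powr (1 - p) = a * (\<delta> ^ ?n / B powr p)"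
  proof -
    have "a powr p = B powr p * \<delta> powr (- real ?n)"
      using B \<delta> p by (simp add: a_def powr_mult powr_powr)
    then show ?thesis using a \<delta> by (simp add: powr_diff powr_minus powr_realpow divide_inverse)
  qed
  have "((\<lambda>y. h (x0 + \<delta> *\<^sub>R y)) has_integral integral ?C (\<lambda>y. h (x0 + \<delta> *\<^sub>R y))) ?C"
    by (intro integrable_integral integrable_continuous continuous_on_compose2[OF cont] continuous_intros) auto
  moreover have "((\<lambda>y. a powr (1 - p) / p * ?h (x0 + \<delta> *\<^sub>R y) + (1 - 1 / p) * a) has_integral
      (a powr (1 - p) / p * (?J / \<delta> ^ ?n) + (1 - 1 / p) * a)) ?C"
    using has_integral_add[OF has_integral_mult_right[OF J, of "a powr (1 - p) / p"]
        has_integral_const[of "(1 - 1 / p) * a" 0 "One::real^'d"]] by simp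
  ultimately have "integral ?C (\<lambda>y. h (x0 + \<delta> *\<^sub>R y)) \<le> a powr (1 - p) / p * (?J / \<delta> ^ ?n) + (1 - 1 / p) * a"
    by (rule has_integral_le) (rule scaled_Young[OF p a nn])
  also have "\<dots> \<le> a powr (1 - p) / p * (2 ^ ?n * B powr p / \<delta> ^ ?n) + (1 - 1 / p) * a"
    using J_le p \<delta> by (intro add_right_mono mult_left_mono divide_right_mono) auto
  also have "\<dots> = a * (2 ^ ?n / p) + a * (1 - 1 / p)"
    using B \<delta> by (simp add: ap field_simps)
  also have "\<dots> \<le> a * (2 ^ ?n / p) + a * (2 ^ ?n * (1 - 1 / p))"
    using a p by (intro add_left_mono mult_left_mono) (auto simp: mult_le_cancel_right1)
  also have "\<dots> = 2 ^ ?n * a" by (simp add: algebra_simps)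
  finally show ?thesis by (simp add: hx0 a_def mult.assoc)
qed

subsection \<open>Comparison at one scale\<close>

lemma smooth_fun_continuous_Dx: "smooth_fun u \<Longrightarrow> continuous_on S (Dx u)"
  unfolding Dx_def by (intro continuous_on_vec_lambda smooth_fun_continuous smooth_fun_dirderiv axis_space_Basis)

lemma smooth_fun_continuous_Dt: "smooth_fun u \<Longrightarrow> continuous_on S (Dt u)"
  unfolding Dt_def by (intro smooth_fun_continuous smooth_fun_dirderiv time_Basis)

lemma smooth_fun_continuous_Lap: "smooth_fun u \<Longrightarrow> continuous_on S (Lap u)"
  unfolding Lap_def by (intro continuous_on_sum smooth_fun_continuous smooth_fun_dirderiv axis_space_Basis)

lemma space_lipschitz:
  fixes u :: "(real^'d::finite) \<times> real \<Rightarrow> real"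
  assumes "smooth_fun u" and L: "\<And>x. norm (Dx u (x, t)) \<le> L"
  shows "\<bar>u (x, t) - u (y, t)\<bar> \<le> L * norm (x - y)"
proof -
  let ?g = "\<lambda>s. u ((y, t) + s *\<^sub>R (x - y, 0))"
  have "norm (?g 1 - ?g 0) \<le> L * norm (x - y) * norm (1 - 0 :: real)"
  proof (rule field_differentiable_bound[where S=UNIV and f="?g" and f'="\<lambda>s. Dx u (y + s *\<^sub>R (x - y), t) \<bullet> (x - y)"])
    fix s :: real
    show "(?g has_field_derivative Dx u (y + s *\<^sub>R (x - y), t) \<bullet> (x - y)) (at s within UNIV)"
      using smooth_fun_line_derivative[OF assms(1), of "(y, t)" "(x - y, 0)" s]
      unfolding sum_Basis_space_time by (simp add: Dx_def inner_vec_def mult.commute)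
    have "norm (Dx u (y + s *\<^sub>R (x - y), t) \<bullet> (x - y)) \<le> norm (Dx u (y + s *\<^sub>R (x - y), t)) * norm (x - y)"
      using Cauchy_Schwarz_ineq2 by simp
    also have "\<dots> \<le> L * norm (x - y)" by (intro mult_right_mono L) simp
    finally show "norm (Dx u (y + s *\<^sub>R (x - y), t) \<bullet> (x - y)) \<le> L * norm (x - y)" .
  qed auto
  then show ?thesis by simp
qed

text \<open>The density has disappeared: \<open>f\<close> is a nonnegative periodic source measured
  only through its L^p bound \<open>B\<close>. The a priori gradient bound \<open>L\<close> enters
  the error terms and is absorbed at the very end.\<close>

locale hamilton_jacobi =
  fixes H :: "real^'d::finite \<Rightarrow> real^'d \<Rightarrow> real" and u f :: "(real^'d) \<times> real \<Rightarrow> real"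
    and T c C3 C5 L LT B p :: real
  assumes smooth_H: "smooth_fun (Hfun H)" and convex_H: "\<And>x. strictly_convex (H x)"
    and H_ge_1: "\<And>x q. 1 \<le> H x q"
    and C5: "0 \<le> C5" and DxH_le: "\<And>x q. norm (DxH H x q) \<le> C5 * H x q + C5"
    and c: "0 < c" and C3: "0 \<le> C3" and Lhat: "\<And>x q. c * H x q - C3 \<le> DpH H x q \<bullet> q - H x q"
    and smooth_u: "smooth_fun u" and periodic_u: "periodic_x u"
    and u_nonneg: "\<And>x t. t \<in> {0..T} \<Longrightarrow> 0 \<le> u (x, t)"
    and equation: "\<And>x t. t \<in> {0..T} \<Longrightarrow> - Dt u (x, t) + H x (Dx u (x, t)) = Lap u (x, t) + f (x, t)"
    and f_nonneg: "\<And>x t. t \<in> {0..T} \<Longrightarrow> 0 \<le> f (x, t)"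
    and periodic_f: "\<And>t. t \<in> {0..T} \<Longrightarrow> periodic_fun (\<lambda>x. f (x, t))"
    and Dx_le: "\<And>x t. t \<in> {0..T} \<Longrightarrow> norm (Dx u (x, t)) \<le> L"
    and T: "0 < T" and Dx_terminal: "\<And>x. norm (Dx u (x, T)) \<le> LT"
    and p: "real CARD('d) < p" and B: "0 < B"
    and f_Lp: "\<And>t. t \<in> {0..T} \<Longrightarrow> integral (cbox 0 One) (\<lambda>x. f (x, t) powr p) \<le> B powr p"
begin

definition n where "n = real CARD('d)"
text \<open>Chosen so that \<open>c * K * r = 2 * C5 * (r + n * r)\<close>, the exponent lost in
  \<open>Hfun_x_gronwall\<close> over the distance \<open>(1 + n) * r\<close>.\<close>

definition K where "K = 2 * C5 * (1 + n) / c"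
text \<open>Larger by 1 than the sum of what the barrier has to beat: the scaling constant, the
  cross term of \<open>laplacians\<close> and the averaged source.\<close>

definition M where "M \<delta> = C3 + 4 * K * L + 2 ^ CARD('d) * B * \<delta> powr (- (n / p)) + 1"

lemma n_ge_1: "1 \<le> n" by (simp add: n_def Suc_leI)

lemma K_nonneg: "0 \<le> K"
  using C5 c n_ge_1 by (simp add: K_def)

lemma L_nonneg: "0 \<le> L"
  using order_trans[OF norm_ge_zero Dx_le[of 0 0]] T by simp

lemma M_pos: "0 < M \<delta>"
  using C3 K_nonneg L_nonneg B by (simp add: M_def add_nonneg_pos)

text \<open>Continuity of \<open>f\<close> in space is read off from the equation, all of whose
  other terms are continuous.\<close>

lemma continuous_f: "t \<in> {0..T} \<Longrightarrow> continuous_on UNIV (\<lambda>x. f (x, t))"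
proof -
  assume t: "t \<in> {0..T}"
  have "(\<lambda>x. f (x, t)) = (\<lambda>x. - Dt u (x, t) + Hfun H (x, Dx u (x, t)) - Lap u (x, t))"
    using equation[OF t] by (simp add: fun_eq_iff Hfun_def algebra_simps)
  then show ?thesis
    by (simp only:) (intro continuous_intros continuous_on_compose2[OF smooth_fun_continuous[OF smooth_H, of UNIV]]
      continuous_on_compose2[OF smooth_fun_continuous_Dx[OF smooth_u, of UNIV]]
      continuous_on_compose2[OF smooth_fun_continuous_Dt[OF smooth_u, of UNIV]]
      continuous_on_compose2[OF smooth_fun_continuous_Lap[OF smooth_u, of UNIV]], auto)
qed

lemma lipschitz: "t \<in> {0..T} \<Longrightarrow> \<bar>u (x, t) - u (y, t)\<bar> \<le> L * norm (x - y)"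
  by (intro space_lipschitz smooth_u Dx_le)

section \<open>Averages of the solution and of its equation\<close>

lemma cube_avg_near:
  assumes t: "t \<in> {0..T}" and "0 \<le> \<delta>"
  shows "\<bar>cube_avg \<delta> u (x, t) - u (x, t)\<bar> \<le> n * L * \<delta>"
proof -
  let ?C = "cbox 0 (One::real^'d)"
  have "((\<lambda>y. u ((x, t) + (\<delta> *\<^sub>R y, 0))) has_integral cube_avg \<delta> u (x, t)) ?C"
    unfolding cube_avg_def by (intro integrable_integral cube_avg_integrable smooth_fun_continuous smooth_u)
  from has_integral_diff[OF this has_integral_const[of "u (x, t)"]]
  have "((\<lambda>y. u ((x, t) + (\<delta> *\<^sub>R y, 0)) - u (x, t)) has_integral cube_avg \<delta> u (x, t) - u (x, t)) ?C"
    by simp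
  moreover have "norm (u ((x, t) + (\<delta> *\<^sub>R y, 0)) - u (x, t)) \<le> n * L * \<delta>" if "y \<in> ?C" for y
  proof -
    have "\<bar>u (x + \<delta> *\<^sub>R y, t) - u (x, t)\<bar> \<le> L * (\<delta> * norm y)"
      using lipschitz[OF t, of "x + \<delta> *\<^sub>R y" x] \<open>0 \<le> \<delta>\<close> by simp
    also have "\<dots> \<le> L * (\<delta> * n)"
      using norm_le_CARD_cube[OF that] \<open>0 \<le> \<delta>\<close> L_nonneg by (intro mult_left_mono) (auto simp: n_def)
    finally show ?thesis by (simp add: algebra_simps)
  qed
  ultimately have "norm (cube_avg \<delta> u (x, t) - u (x, t)) \<le> n * L * \<delta> * measure lborel ?C"
    using n_ge_1 L_nonneg \<open>0 \<le> \<delta>\<close> by (intro has_integral_bound) auto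
  then show ?thesis by simp
qed

lemma Dx_cube_avg: "Dx (cube_avg \<delta> u) (x, t) = integral (cbox 0 One) (\<lambda>y. Dx u (x + \<delta> *\<^sub>R y, t))"
proof -
  have "(\<lambda>y. Dx u (x + \<delta> *\<^sub>R y, t)) integrable_on cbox 0 One"
    by (intro integrable_continuous continuous_on_compose2[OF smooth_fun_continuous_Dx[OF smooth_u, of UNIV]]
      continuous_intros) auto
  then have "integral (cbox 0 One) (\<lambda>y. Dx u (x + \<delta> *\<^sub>R y, t)) $ i
      = integral (cbox 0 One) (\<lambda>y. Dx u (x + \<delta> *\<^sub>R y, t) $ i)" for i
    by simp
  then show ?thesis
    by (simp add: vec_eq_iff Dx_def dirderiv_cube_avg smooth_u cube_avg_def)
qed

lemma norm_Dx_cube_avg: "t \<in> {0..T} \<Longrightarrow> norm (Dx (cube_avg \<delta> u) (x, t)) \<le> L"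
proof -
  assume t: "t \<in> {0..T}"
  have "((\<lambda>y. Dx u (x + \<delta> *\<^sub>R y, t)) has_integral Dx (cube_avg \<delta> u) (x, t)) (cbox 0 One)"
    unfolding Dx_cube_avg
    by (intro integrable_integral integrable_continuous
      continuous_on_compose2[OF smooth_fun_continuous_Dx[OF smooth_u, of UNIV]] continuous_intros) auto
  from has_integral_bound[OF L_nonneg this] Dx_le[OF t] show ?thesis by simp
qed

text \<open>The linear terms commute with averaging, while the Hamiltonian is left as an average, to
  be bounded below by convexity.\<close>

lemma averaged_equation:
  assumes t: "t \<in> {0..T}"
  shows "Dt (cube_avg \<delta> u) (x, t) + Lap (cube_avg \<delta> u) (x, t) + integral (cbox 0 One) (\<lambda>y. f (x + \<delta> *\<^sub>R y, t))
    = integral (cbox 0 One) (\<lambda>y. H (x + \<delta> *\<^sub>R y) (Dx u (x + \<delta> *\<^sub>R y, t)))"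
proof -
  let ?C = "cbox 0 (One::real^'d)"
  have avg: "((\<lambda>y. g (x + \<delta> *\<^sub>R y, t)) has_integral cube_avg \<delta> g (x, t)) ?C"
    if "continuous_on UNIV g" for g :: "(real^'d) \<times> real \<Rightarrow> real"
    using cube_avg_integrable[OF that, of "(x, t)" \<delta>] unfolding cube_avg_def by (simp add: integrable_integral)
  have "Dt (cube_avg \<delta> u) (x, t) = cube_avg \<delta> (Dt u) (x, t)"
    by (simp add: Dt_def[abs_def] dirderiv_cube_avg smooth_u)
  with avg[OF smooth_fun_continuous_Dt[OF smooth_u]]
  have 1: "((\<lambda>y. Dt u (x + \<delta> *\<^sub>R y, t)) has_integral Dt (cube_avg \<delta> u) (x, t)) ?C" by simp
  have 2: "((\<lambda>y. Lap u (x + \<delta> *\<^sub>R y, t)) has_integral Lap (cube_avg \<delta> u) (x, t)) ?C"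
    unfolding Lap_def
    by (intro has_integral_sum) (auto simp: dirderiv_cube_avg smooth_u smooth_fun_dirderiv
        intro!: avg smooth_fun_continuous)
  have 3: "((\<lambda>y. f (x + \<delta> *\<^sub>R y, t)) has_integral integral ?C (\<lambda>y. f (x + \<delta> *\<^sub>R y, t))) ?C"
    by (intro integrable_integral integrable_continuous continuous_on_compose2[OF continuous_f[OF t]]
      continuous_intros) auto
  have "Dt u (z, t) + Lap u (z, t) + f (z, t) = H z (Dx u (z, t))" for z
    using equation[OF t, of z] by simp
  with has_integral_add[OF has_integral_add[OF 1 2] 3] show ?thesis
    by (simp add: integral_unique)
qed

text \<open>Jensen's inequality is applied with the space variable frozen at \<open>y\<close>; then
  \<open>Hfun_x_gronwall\<close> moves it to \<open>x + \<delta> *\<^sub>R z\<close>, which is at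
  distance at most \<open>(1 + n) * norm (x - y)\<close> because
  \<open>\<delta> \<le> norm (x - y)\<close>.\<close>

lemma averaged_hamiltonian_ge:
  assumes t: "t \<in> {0..T}" and \<delta>: "0 < \<delta>" "\<delta> \<le> norm (x - y)"
  shows "exp (- (c * K * norm (x - y))) * H y (Dx (cube_avg \<delta> u) (x, t))
    \<le> integral (cbox 0 One) (\<lambda>z. H (x + \<delta> *\<^sub>R z) (Dx u (x + \<delta> *\<^sub>R z, t)))"
proof -
  let ?C = "cbox 0 (One::real^'d)" and ?r = "norm (x - y)"
  let ?P = "\<lambda>z. Dx u (x + \<delta> *\<^sub>R z, t)"
  have P: "continuous_on ?C ?P"
    by (intro continuous_on_compose2[OF smooth_fun_continuous_Dx[OF smooth_u, of UNIV]] continuous_intros) auto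
  have Hc: "continuous_on UNIV (Hfun H)" by (rule smooth_fun_continuous[OF smooth_H])
  have H1: "continuous_on ?C (\<lambda>z. Hfun H (y, ?P z))" and H2: "continuous_on ?C (\<lambda>z. Hfun H (x + \<delta> *\<^sub>R z, ?P z))"
    by (intro continuous_on_compose2[OF Hc] continuous_intros P; auto)+
  have "exp (- (c * K * ?r)) * H y (Dx (cube_avg \<delta> u) (x, t)) \<le> exp (- (c * K * ?r)) * integral ?C (\<lambda>z. H y (?P z))"
    unfolding Dx_cube_avg by (intro mult_left_mono Hfun_p_jensen smooth_H convex_H P) auto
  also have "\<dots> = integral ?C (\<lambda>z. exp (- (c * K * ?r)) * H y (?P z))" by simp
  also have "\<dots> \<le> integral ?C (\<lambda>z. H (x + \<delta> *\<^sub>R z) (?P z))"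
  proof (rule integral_le)
    show "(\<lambda>z. exp (- (c * K * ?r)) * H y (?P z)) integrable_on ?C"
      using H1 by (intro integrable_continuous continuous_intros) (simp add: Hfun_def)
    show "(\<lambda>z. H (x + \<delta> *\<^sub>R z) (?P z)) integrable_on ?C"
      using H2 by (intro integrable_continuous) (simp add: Hfun_def)
    fix z assume z: "z \<in> ?C"
    have "norm (x + \<delta> *\<^sub>R z - y) \<le> ?r + \<delta> * norm z"
      using norm_triangle_ineq[of "x - y" "\<delta> *\<^sub>R z"] \<delta> by (simp add: algebra_simps)
    also have "\<dots> \<le> ?r + ?r * n"
      using norm_le_CARD_cube[OF z] \<delta> by (intro add_left_mono mult_mono) (auto simp: n_def)
    finally have "2 * C5 * norm (x + \<delta> *\<^sub>R z - y) \<le> 2 * C5 * (?r + ?r * n)"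
      using C5 by (intro mult_left_mono) auto
    also have "\<dots> = c * K * ?r"
    proof -
      have "c * K = 2 * C5 * (1 + n)" using c by (simp add: K_def)
      then show ?thesis by (simp add: algebra_simps)
    qed
    finally have "exp (- (c * K * ?r)) * H y (?P z) \<le> exp (- (2 * C5 * norm (x + \<delta> *\<^sub>R z - y))) * H y (?P z)"
      using H_ge_1[of y "?P z"] by (intro mult_right_mono) auto
    also have "\<dots> \<le> H (x + \<delta> *\<^sub>R z) (?P z)"
      by (rule Hfun_x_gronwall[OF smooth_H H_ge_1 C5 DxH_le])
    finally show "exp (- (c * K * ?r)) * H y (?P z) \<le> H (x + \<delta> *\<^sub>R z) (?P z)" .
  qed
  finally show ?thesis .
qed

text \<open>The equations at the two points are compared. The gradient at \<open>y\<close> is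
  \<open>s *\<^sub>R q\<close> with \<open>s = 1 - K * r\<close>, and the superlinear gain from this
  shrinking pays for the change of the space variable in \<open>H\<close>. What remains is too small
  for the curvature \<open>M \<delta>\<close>.\<close>

lemma not_coupling_max:
  assumes \<delta>: "0 < \<delta>" "\<delta> \<le> 1" "\<delta> \<le> norm (x - y)" and K: "K * norm (x - y) < 1"
    and "coupling_max (cube_avg \<delta> u) u K a S (M \<delta>) R T x y t"
  shows False
proof -
  interpret coupling_max "cube_avg \<delta> u" u K a S "M \<delta>" R T x y t by fact
  let ?v = "cube_avg \<delta> u" and ?C = "cbox 0 (One::real^'d)"
  have t': "t \<in> {0..T}" using t by simp
  define s where "s = 1 - K * r"
  define q where "q = Dx ?v (x, t)"
  define avH where "avH = integral ?C (\<lambda>z. H (x + \<delta> *\<^sub>R z) (Dx u (x + \<delta> *\<^sub>R z, t)))"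
  define avf where "avf = integral ?C (\<lambda>z. f (x + \<delta> *\<^sub>R z, t))"
  have Kr: "0 \<le> K * r" using K_nonneg by simp
  have s: "0 < s" "s \<le> 1" using K Kr by (auto simp: s_def)
  have "0 \<le> avf"
    unfolding avf_def using f_nonneg[OF t']
    by (intro integral_nonneg integrable_continuous continuous_on_compose2[OF continuous_f[OF t']] continuous_intros) auto
  have avf: "avf \<le> 2 ^ CARD('d) * B * \<delta> powr (- (n / p))"
    unfolding avf_def n_def
    by (rule cube_average_le_Lp[OF continuous_f[OF t'] f_nonneg[OF t'] periodic_f[OF t'] _ \<delta>(1,2) B f_Lp[OF t']])
      (use p n_ge_1 in \<open>unfold n_def, linarith\<close>)
  \<comment> \<open>Both equations are solved for the time derivative and inserted into
    \<open>time_derivatives\<close>.\<close>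
  have time: "s * (avH - Lap ?v (x, t) - avf) \<le> H y (s *\<^sub>R q) - Lap u (y, t) - f (y, t)"
  proof -
    have "Dt ?v (x, t) = avH - Lap ?v (x, t) - avf"
      using averaged_equation[OF t', of \<delta> x] by (simp add: avH_def avf_def)
    moreover have "Dt u (y, t) = H y (s *\<^sub>R q) - Lap u (y, t) - f (y, t)"
      using equation[OF t', of y] gradients by (simp add: s_def q_def)
    ultimately show ?thesis
      using time_derivatives by (simp add: s_def)
  qed
  have "H y (s *\<^sub>R q) \<le> s powr (1 + c) * H y q + C3"
    by (rule Hfun_p_scaling[OF smooth_H c C3 Lhat s])
  \<comment> \<open>From \<open>ln s \<le> s - 1 = - (K * r)\<close>: the gain
    \<open>s powr c\<close> is at most the factor lost in
    \<open>averaged_hamiltonian_ge\<close>.\<close>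
  also have "s powr (1 + c) \<le> s * exp (- (c * K * r))"
  proof -
    have "ln s \<le> - (K * r)" using ln_le_minus_one[OF s(1)] by (simp add: s_def)
    then have "c * ln s \<le> - (c * K * r)" using c mult_left_mono[of "ln s" "- (K * r)" c] by simp
    then show ?thesis using s by (simp add: powr_add) (simp add: powr_def)
  qed
  then have "s powr (1 + c) * H y q + C3 \<le> s * exp (- (c * K * r)) * H y q + C3"
    using H_ge_1[of y q] by (intro add_right_mono mult_right_mono) auto
  also have "\<dots> \<le> s * avH + C3"
    using averaged_hamiltonian_ge[OF t' \<delta>(1,3)] s
    by (simp add: avH_def q_def mult.assoc)
  finally have "H y (s *\<^sub>R q) \<le> s * avH + C3" .
  moreover have "s * avf \<le> avf" using s \<open>0 \<le> avf\<close> by (simp add: mult_left_le_one_le)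
  moreover have "4 * K * (e \<bullet> q) \<le> 4 * K * L"
  proof (intro mult_left_mono)
    have "e \<bullet> q \<le> norm e * norm q" by (rule norm_cauchy_schwarz)
    also have "\<dots> \<le> L" using norm_Dx_cube_avg[OF t'] by (simp add: norm_e q_def)
    finally show "e \<bullet> q \<le> L" .
  qed (use K_nonneg in simp)
  \<comment> \<open>The terms \<open>s * avH\<close> cancel, and \<open>f (y, t)\<close> is dropped
    by its sign.\<close>
  ultimately have "4 * M \<delta> \<le> C3 + 4 * K * L + avf"
    using time laplacians f_nonneg[OF t', of y] by (simp add: s_def q_def algebra_simps)
  then have "4 * M \<delta> \<le> M \<delta> - 1" using avf unfolding M_def by linarith
  then show False using M_pos[of \<delta>] by simp
qed

text \<open>The averaged function satisfies the equation with a right-hand side bounded by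
  \<open>2 ^ CARD('d) * B * \<delta> powr (- (n / p))\<close>; the curvature \<open>- M \<delta>\<close> of the barrier beats it.\<close>

lemma averaged_comparison:
  assumes R: "0 < R" "K * R < 1" and \<delta>: "0 < \<delta>" "\<delta> \<le> 1" "\<delta> \<le> R" and S: "0 \<le> S" "LT \<le> S"
    and bdry: "\<And>x y t. t \<in> {0..T} \<Longrightarrow> norm (x - y) = R \<Longrightarrow> (1 - K * R) * u (x, t) - u (y, t) \<le> S * R"
    and t: "t \<in> {0..T}" and xy: "norm (x - y) \<le> R"
  shows "(1 - K * norm (x - y)) * cube_avg \<delta> u (x, t) - u (y, t)
    \<le> (n + 1) * L * \<delta> + S * norm (x - y) + M \<delta> / 2 * (norm (x - y) * (R - norm (x - y)))"
proof (rule ccontr)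
  assume contra: "\<not> ?thesis"
  let ?v = "cube_avg \<delta> u" and ?C = "cbox 0 (One::real^'d)"
  \<comment> \<open>In the offset, \<open>n * L * \<delta>\<close> pays for replacing the average by
    \<open>u\<close>, and the extra \<open>L * \<delta>\<close> rules out a maximum at distance
    below \<open>\<delta>\<close>.\<close>
  define \<phi> where "\<phi> r = (n + 1) * L * \<delta> + S * r + M \<delta> / 2 * (r * (R - r))" for r
  define \<Psi> where "\<Psi> = (\<lambda>(x, y, t). (1 - K * norm (x - y)) * ?v (x, t) - u (y, t) - \<phi> (norm (x - y)))"
  \<comment> \<open>A common lattice translation brings \<open>x\<close> into the unit cube and
    \<open>y\<close> into a fixed ball, so the supremum is attained on a compact set.\<close>
  define D where "D = (?C \<times> cball 0 (R + n) \<times> {0..T}) \<inter> {z. norm (fst z - fst (snd z)) \<le> R}"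
  have "compact D"
    unfolding D_def
    by (intro compact_Int_closed compact_Times compact_cbox compact_cball compact_Icc closed_Collect_le continuous_intros)
  have shift: "\<exists>x0 y0. (x0, y0, t') \<in> D \<and> \<Psi> (x0, y0, t') = \<Psi> (x', y', t')"
    if "norm (x' - y') \<le> R" "t' \<in> {0..T}" for x' y' t'
  proof (intro exI conjI)
    let ?k = "floor_vec x'"
    have C: "x' - ?k \<in> ?C" by (rule diff_floor_vec_in_cube)
    have "norm (y' - ?k) \<le> norm (x' - y') + norm (x' - ?k)"
      using norm_triangle_ineq[of "y' - x'" "x' - ?k"] by (simp add: norm_minus_commute)
    also have "\<dots> \<le> R + n" using that norm_le_CARD_cube[OF C] by (simp add: n_def)
    finally show "(x' - ?k, y' - ?k, t') \<in> D" using C that by (simp add: D_def)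
    have per: "periodic_fun (\<lambda>x. u (x, t'))" using periodic_u by (simp add: periodic_x_def)
    have "u (x' - ?k + \<delta> *\<^sub>R y, t') = u (x' + \<delta> *\<^sub>R y, t')" for y
      using periodic_fun_floor_vec[OF per, of "x' + \<delta> *\<^sub>R y" x'] by (simp add: algebra_simps)
    then have "?v (x' - ?k, t') = ?v (x', t')" by (simp add: cube_avg_def)
    then show "\<Psi> (x' - ?k, y' - ?k, t') = \<Psi> (x', y', t')"
      using periodic_fun_floor_vec[OF per] by (simp add: \<Psi>_def)
  qed
  have "D \<noteq> {}" using shift[OF xy t] by blast
  moreover have "continuous_on D \<Psi>"
    unfolding \<Psi>_def \<phi>_def split_beta
    by (intro continuous_intros continuous_on_compose2[OF cube_avg_continuous[OF smooth_fun_continuous[OF smooth_u]]]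
      continuous_on_compose2[OF smooth_fun_continuous[OF smooth_u, of UNIV]]) auto
  ultimately obtain z where z: "z \<in> D" and z_max: "\<And>w. w \<in> D \<Longrightarrow> \<Psi> w \<le> \<Psi> z"
    using continuous_attains_sup[OF \<open>compact D\<close>] by blast
  obtain a b \<tau> where ab: "z = (a, b, \<tau>)" by (metis prod.exhaust)
  define r where "r = norm (a - b)"
  have mx: "\<Psi> (x', y', t') \<le> \<Psi> (a, b, \<tau>)" if "norm (x' - y') \<le> R" "t' \<in> {0..T}" for x' y' t'
    using shift[OF that] z_max ab by metis
  have r: "0 \<le> r" "r \<le> R" and \<tau>: "\<tau> \<in> {0..T}" using z by (auto simp: ab D_def r_def)
  have "0 < \<Psi> (x, y, t)" using contra by (simp add: \<Psi>_def \<phi>_def)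
  then have pos: "\<phi> r < (1 - K * r) * ?v (a, \<tau>) - u (b, \<tau>)"
    using mx[OF xy t] by (simp add: \<Psi>_def r_def)
  have bump: "0 \<le> M \<delta> / 2 * (r * (R - r))" using r M_pos[of \<delta>] by simp
  have Kr: "0 \<le> K * r" "K * r < 1"
    using r K_nonneg R mult_left_mono[of r R K] by auto
  \<comment> \<open>This sign, inherited from \<open>u\<close>, makes the factor
    \<open>1 - K * r\<close> only decrease the averaged term.\<close>
  have v_nonneg: "0 \<le> ?v (a, \<tau>)"
    unfolding cube_avg_def
    by (intro integral_nonneg cube_avg_integrable smooth_fun_continuous smooth_u) (use u_nonneg[OF \<tau>] in auto)
  have v_le: "?v (a, \<tau>) \<le> u (a, \<tau>) + n * L * \<delta>"
    using cube_avg_near[OF \<tau>, of \<delta> a] \<delta> by simp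
  have up: "(1 - K * r) * ?v (a, \<tau>) \<le> u (a, \<tau>) + n * L * \<delta>"
    using mult_right_mono[of "1 - K * r" 1 "?v (a, \<tau>)"] Kr v_nonneg v_le by simp
  have low: "n * L * \<delta> + L * \<delta> + S * r \<le> \<phi> r"
    using bump by (simp add: \<phi>_def distrib_right)
  have L\<delta>: "0 \<le> L * \<delta>" using L_nonneg \<delta> by simp
  have "\<delta> \<le> r"
  proof (rule ccontr)
    assume "\<not> \<delta> \<le> r"
    then have "L * r \<le> L * \<delta>" using L_nonneg by (intro mult_left_mono) auto
    moreover have "u (a, \<tau>) - u (b, \<tau>) \<le> L * r" using lipschitz[OF \<tau>, of a b] by (simp add: r_def)
    moreover have "0 \<le> S * r" using S r by simp
    ultimately show False using pos up low by linarith
  qed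
  \<comment> \<open>At \<open>r = R\<close> the concave bump vanishes and the slope hypothesis
    \<open>bdry\<close> contradicts positivity of the maximum.\<close>
  moreover have "r < R"
  proof (rule ccontr)
    assume "\<not> r < R"
    then have "r = R" using r by simp
    have "(1 - K * R) * ?v (a, \<tau>) \<le> (1 - K * R) * u (a, \<tau>) + (1 - K * R) * (n * L * \<delta>)"
      using mult_left_mono[OF v_le, of "1 - K * R"] R by (simp add: algebra_simps)
    also have "(1 - K * R) * (n * L * \<delta>) \<le> n * L * \<delta>"
      using R K_nonneg n_ge_1 L_nonneg \<delta> by (intro mult_left_le_one_le) auto
    finally show False
      using pos bdry[OF \<tau>, of a b] L\<delta> \<open>r = R\<close> unfolding \<phi>_def r_def[symmetric]
      by (simp add: algebra_simps)
  qed
  \<comment> \<open>At the terminal time the slope is at most \<open>LT \<le> S\<close>, which the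
    linear part of the barrier covers.\<close>
  moreover have "\<tau> < T"
  proof (rule ccontr)
    assume "\<not> \<tau> < T"
    then have "\<tau> = T" using \<tau> by simp
    have "u (a, \<tau>) - u (b, \<tau>) \<le> LT * r"
      using space_lipschitz[OF smooth_u Dx_terminal, of a b] by (simp add: r_def \<open>\<tau> = T\<close>)
    also have "\<dots> \<le> S * r" using S r by (intro mult_right_mono) auto
    finally show False using pos up low L\<delta> by linarith
  qed
  moreover have "coupling_max ?v u K ((n + 1) * L * \<delta>) S (M \<delta>) R T a b \<tau>"
  proof
    show "smooth_fun ?v" by (rule smooth_fun_cube_avg[OF smooth_u])
    show "a \<noteq> b" using \<open>\<delta> \<le> r\<close> \<delta> by (auto simp: r_def)
    fix x' y' :: "real^'d" and t' assume "norm (x' - y') < R" "t' \<in> {0..T}"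
    then show "(1 - K * norm (x' - y')) * ?v (x', t') - u (y', t')
        - ((n + 1) * L * \<delta> + S * norm (x' - y') + M \<delta> / 2 * (norm (x' - y') * (R - norm (x' - y'))))
      \<le> (1 - K * norm (a - b)) * ?v (a, \<tau>) - u (b, \<tau>)
        - ((n + 1) * L * \<delta> + S * norm (a - b) + M \<delta> / 2 * (norm (a - b) * (R - norm (a - b))))"
      using mx[of x' y' t'] by (simp add: \<Psi>_def \<phi>_def)
  qed (use smooth_u \<tau> \<open>r < R\<close> \<open>\<tau> < T\<close> in \<open>auto simp: r_def\<close>)
  ultimately show False
    using not_coupling_max[OF \<delta>(1,2)] Kr by (simp add: r_def)
qed

text \<open>The barrier is evaluated at distance \<open>R / 2\<close>, where its bump equals
  \<open>M \<delta> * R / 4\<close> times \<open>R / 2\<close>. Passing from the average back to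
  \<open>u\<close> costs another \<open>n * L * \<delta>\<close>.\<close>

lemma halving_step:
  assumes R: "0 < R" "K * R < 1" and \<delta>: "0 < \<delta>" "\<delta> \<le> 1" "\<delta> \<le> R" and S: "0 \<le> S" "LT \<le> S"
    and bdry: "\<And>x y t. t \<in> {0..T} \<Longrightarrow> norm (x - y) = R \<Longrightarrow> (1 - K * R) * u (x, t) - u (y, t) \<le> S * R"
    and t: "t \<in> {0..T}" and xy: "norm (x - y) = R / 2"
  shows "(1 - K * (R / 2)) * u (x, t) - u (y, t) \<le> (S + 4 * (n + 1) * L * \<delta> / R + M \<delta> * R / 4) * (R / 2)"
proof -
  have K: "0 \<le> 1 - K * (R / 2)" "1 - K * (R / 2) \<le> 1" using R K_nonneg by auto
  have "u (x, t) \<le> cube_avg \<delta> u (x, t) + n * L * \<delta>"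
    using cube_avg_near[OF t, of \<delta> x] \<delta> by simp
  then have "(1 - K * (R / 2)) * u (x, t) \<le> (1 - K * (R / 2)) * cube_avg \<delta> u (x, t) + (1 - K * (R / 2)) * (n * L * \<delta>)"
    using mult_left_mono[OF _ K(1)] by (metis distrib_left)
  also have "(1 - K * (R / 2)) * (n * L * \<delta>) \<le> n * L * \<delta>"
    using K n_ge_1 L_nonneg \<delta> by (intro mult_left_le_one_le) auto
  finally have "(1 - K * (R / 2)) * u (x, t) - u (y, t)
      \<le> (1 - K * (R / 2)) * cube_avg \<delta> u (x, t) - u (y, t) + n * L * \<delta>" by simp
  also have "\<dots> \<le> (n + 1) * L * \<delta> + S * (R / 2) + M \<delta> / 2 * (R / 2 * (R - R / 2)) + n * L * \<delta>"
    using averaged_comparison[OF R \<delta> S bdry t, of x y] xy R by simp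
  also have "\<dots> \<le> (S + 4 * (n + 1) * L * \<delta> / R + M \<delta> * R / 4) * (R / 2)"
  proof -
    have "(S + 4 * (n + 1) * L * \<delta> / R + M \<delta> * R / 4) * (R / 2)
      = S * (R / 2) + 2 * (n + 1) * (L * \<delta>) + M \<delta> * R * R / 8"
      using R by (simp add: field_simps)
    moreover have "0 \<le> L * \<delta>" using L_nonneg \<delta> by simp
    ultimately show ?thesis by (simp add: algebra_simps)
  qed
  finally show ?thesis .
qed

end

subsection \<open>Iteration over dyadic scales\<close>

context hamilton_jacobi
begin

text \<open>The solution of \<open>\<tau> = 1 - (1 + \<tau>) * (n / p)\<close>; it is positive
  because \<open>n < p\<close>.\<close>

definition \<tau> where "\<tau> = (1 - n / p) / (1 + n / p)"
text \<open>Collects the coefficients of \<open>R powr \<tau>\<close> in both losses; the part of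
  \<open>M \<delta>\<close> free of \<open>\<delta>\<close> is included through
  \<open>R \<le> R powr \<tau>\<close>.\<close>

definition E where "E = 4 * (n + 1) * L + 4 * K * L + C3 + 1 + 2 ^ CARD('d) * B"

lemma np: "0 < n / p" "n / p < 1"
  using p n_ge_1 by (auto simp: n_def)

lemma \<tau>: "0 < \<tau>" "\<tau> \<le> 1"
  using np by (auto simp: \<tau>_def)

text \<open>The averaging scale \<open>\<delta> = R powr (1 + \<tau>)\<close> balances the two losses of \<open>halving_step\<close>:
  \<open>\<delta> / R\<close> and \<open>\<delta> powr (- (n / p)) * R\<close> are both \<open>R powr \<tau>\<close>.\<close>

lemma halving_step_powr:
  assumes R: "0 < R" "R \<le> 1" "K * R < 1" and S: "0 \<le> S" "LT \<le> S"
    and bdry: "\<And>x y t. t \<in> {0..T} \<Longrightarrow> norm (x - y) = R \<Longrightarrow> (1 - K * R) * u (x, t) - u (y, t) \<le> S * R"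
    and t: "t \<in> {0..T}" and xy: "norm (x - y) = R / 2"
  shows "(1 - K * (R / 2)) * u (x, t) - u (y, t) \<le> (S + E * R powr \<tau>) * (R / 2)"
proof -
  define \<delta> where "\<delta> = R powr (1 + \<tau>)"
  have \<delta>R: "\<delta> = R powr \<tau> * R" using R by (simp add: \<delta>_def powr_add)
  have R\<tau>: "0 < R powr \<tau>" "R powr \<tau> \<le> 1" "R \<le> R powr \<tau>"
    using R \<tau> powr_le1[of \<tau> R] powr_mono'[of \<tau> 1 R] by auto
  have "\<delta> \<le> R" using R R\<tau> mult_right_mono[of "R powr \<tau>" 1 R] by (simp add: \<delta>R)
  with R have \<delta>: "0 < \<delta>" "\<delta> \<le> R" "\<delta> \<le> 1" by (auto simp: \<delta>_def)
  have "\<delta> powr (- (n / p)) * R = R powr \<tau>"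
  proof -
    have "(1 + \<tau>) * (n / p) = 1 - \<tau>" using np by (simp add: \<tau>_def field_simps)
    then have "\<delta> powr (- (n / p)) = R powr (\<tau> - 1)" by (simp add: \<delta>_def powr_powr)
    then show ?thesis using R by (simp add: powr_diff)
  qed
  then have "M \<delta> * R = (C3 + 4 * K * L + 1) * R + 2 ^ CARD('d) * B * R powr \<tau>"
    by (simp add: M_def distrib_right mult.assoc)
  also have "\<dots> \<le> (C3 + 4 * K * L + 1) * R powr \<tau> + 2 ^ CARD('d) * B * R powr \<tau>"
    using C3 K_nonneg L_nonneg R\<tau> by (intro add_right_mono mult_left_mono) auto
  finally have "M \<delta> * R \<le> (C3 + 4 * K * L + 1 + 2 ^ CARD('d) * B) * R powr \<tau>"
    by (simp add: distrib_right)
  moreover have "M \<delta> * R / 4 \<le> M \<delta> * R" using M_pos[of \<delta>] R by simp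
  ultimately have "M \<delta> * R / 4 \<le> (C3 + 4 * K * L + 1 + 2 ^ CARD('d) * B) * R powr \<tau>"
    by (rule order_trans[rotated])
  moreover have "4 * (n + 1) * L * \<delta> / R = 4 * (n + 1) * L * R powr \<tau>" using R by (simp add: \<delta>R)
  ultimately have "S + 4 * (n + 1) * L * \<delta> / R + M \<delta> * R / 4 \<le> S + E * R powr \<tau>"
    by (simp only: E_def distrib_right)
  then have "(S + 4 * (n + 1) * L * \<delta> / R + M \<delta> * R / 4) * (R / 2) \<le> (S + E * R powr \<tau>) * (R / 2)"
    using R by (intro mult_right_mono) auto
  with halving_step[OF R(1,3) \<delta>(1,3,2) S bdry t xy] show ?thesis by simp
qed

text \<open>A gradient longer than \<open>G\<close> would make \<open>u\<close> grow faster than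
  \<open>G\<close> along its own direction at all small distances, hence at some dyadic one.\<close>

lemma gradient_le:
  assumes t: "t \<in> {0..T}" and G: "0 \<le> G" and R: "0 < R"
    and slope: "\<And>k x. norm (x - y) = R / 2 ^ k \<Longrightarrow> u (x, t) - u (y, t) \<le> G * (R / 2 ^ k)"
  shows "norm (Dx u (y, t)) \<le> G"
proof (rule ccontr)
  assume neg: "\<not> norm (Dx u (y, t)) \<le> G"
  define g where "g = Dx u (y, t)"
  define w where "w = (1 / norm g) *\<^sub>R g"
  have g: "G < norm g" "g \<noteq> 0" using neg G by (auto simp: g_def)
  have w: "norm w = 1" "g \<bullet> w = norm g"
    using g by (simp_all add: w_def dot_square_norm power2_eq_square)
  let ?g = "\<lambda>s. u ((y, t) + s *\<^sub>R (w, 0)) - G * s"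
  have "((\<lambda>s. u ((y, t) + s *\<^sub>R (w, 0))) has_real_derivative g \<bullet> w) (at 0)"
    using smooth_fun_line_derivative[OF smooth_u, of "(y, t)" "(w, 0)" 0]
    unfolding sum_Basis_space_time by (simp add: g_def Dx_def inner_vec_def mult.commute)
  then have "(?g has_real_derivative norm g - G) (at 0)"
    by (auto intro!: derivative_eq_intros simp: w)
  from DERIV_pos_inc_right[OF this] g obtain d where "d > 0"
    and d: "\<And>h. 0 < h \<Longrightarrow> h < d \<Longrightarrow> ?g 0 < ?g (0 + h)" by auto
  obtain k where "R / d < 2 ^ k" using real_arch_pow[of 2 "R / d"] by auto
  then have k: "R / 2 ^ k < d" "0 < R / 2 ^ k" using \<open>d > 0\<close> R by (auto simp: field_simps)
  have "norm (y + (R / 2 ^ k) *\<^sub>R w - y) = R / 2 ^ k" using w R by simp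
  from slope[OF this] d[OF k(2,1)] show False by simp
qed

text \<open>The errors \<open>E * r powr \<tau>\<close> form a geometric series of ratio
  \<open>2 powr (- \<tau>)\<close>; the closed form of its partial sums makes the induction
  exact.\<close>

lemma slope_at_scale:
  assumes R: "0 < R" "R \<le> 1" "K * R < 1" and S: "0 \<le> S" "LT \<le> S"
    and bdry: "\<And>x y t. t \<in> {0..T} \<Longrightarrow> norm (x - y) = R \<Longrightarrow> (1 - K * R) * u (x, t) - u (y, t) \<le> S * R"
  shows "\<And>x y t. t \<in> {0..T} \<Longrightarrow> norm (x - y) = R / 2 ^ k \<Longrightarrow> (1 - K * (R / 2 ^ k)) * u (x, t) - u (y, t)
    \<le> (S + E / (1 - 2 powr (- \<tau>)) * (R powr \<tau> - (R / 2 ^ k) powr \<tau>)) * (R / 2 ^ k)"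
proof (induction k)
  case 0
  then show ?case using bdry by simp
next
  case (Suc k)
  define r where "r = R / 2 ^ k"
  define E' where "E' = E / (1 - 2 powr (- \<tau>))"
  have \<kappa>: "0 < 1 - 2 powr (- \<tau>)" using \<tau> by (simp add: powr_less_one)
  have "0 \<le> E" using L_nonneg n_ge_1 K_nonneg C3 B by (simp add: E_def)
  then have E': "0 \<le> E'" "E' * (1 - 2 powr (- \<tau>)) = E" using \<kappa> by (auto simp: E'_def)
  have r: "0 < r" "r \<le> R" using R by (auto simp: r_def field_simps)
  have "K * r < 1" using mult_left_mono[OF r(2) K_nonneg] R by simp
  \<comment> \<open>The slope reached at scale \<open>r\<close>. It only grows from
    \<open>S\<close>, so \<open>LT \<le> S'\<close> and the halving can be repeated.\<close>
  define S' where "S' = S + E' * (R powr \<tau> - r powr \<tau>)"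
  have "0 \<le> E' * (R powr \<tau> - r powr \<tau>)" using E' r \<tau> by (simp add: powr_mono2)
  then have S': "0 \<le> S'" "LT \<le> S'" using S by (auto simp: S'_def)
  have half: "R / 2 ^ Suc k = r / 2" by (simp add: r_def)
  have "(1 - K * (r / 2)) * u (x, t) - u (y, t) \<le> (S' + E * r powr \<tau>) * (r / 2)"
  proof (rule halving_step_powr[OF r(1) _ \<open>K * r < 1\<close> S'])
    show "r \<le> 1" using r R by simp
    show "(1 - K * r) * u (x, t) - u (y, t) \<le> S' * r" if "t \<in> {0..T}" "norm (x - y) = r" for x y t
      using Suc.IH[OF that(1), of x y] that(2) by (simp add: r_def S'_def E'_def)
    show "norm (x - y) = r / 2" using Suc.prems(2) unfolding half .
  qed (rule Suc.prems(1))
  also have "S' + E * r powr \<tau> = S + E' * (R powr \<tau> - (r / 2) powr \<tau>)"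
  proof -
    have half_powr: "(r / 2) powr \<tau> = r powr \<tau> * 2 powr (- \<tau>)"
      using powr_divide[of r 2 \<tau>] r powr_minus_divide[of 2 \<tau>] by simp
    have "S + E' * (a - b) + (E' * (1 - d)) * b = S + E' * (a - b * d)" for a b d
      by (simp add: algebra_simps)
    from this[of "R powr \<tau>" "r powr \<tau>" "2 powr (- \<tau>)"]
    show ?thesis unfolding half_powr S'_def E'(2) .
  qed
  finally show ?case unfolding half E'_def .
qed

text \<open>At the starting scale \<open>R\<close> the slope bound comes just from
  \<open>0 \<le> u \<le> U\<close>. At the end, removing the factor \<open>1 - K * r\<close> adds
  \<open>K * U\<close> to the slope.\<close>

theorem gradient_estimate:
  assumes R: "0 < R" "R \<le> 1" "K * R < 1"
    and u_le: "\<And>x t. t \<in> {0..T} \<Longrightarrow> u (x, t) \<le> U"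
    and t: "t \<in> {0..T}"
  shows "norm (Dx u (y, t)) \<le> (K + 1 / R) * U + LT + E / (1 - 2 powr (- \<tau>)) * R powr \<tau>"
proof -
  define E' where "E' = E / (1 - 2 powr (- \<tau>))"
  have \<kappa>: "0 < 1 - 2 powr (- \<tau>)" using \<tau> by (simp add: powr_less_one)
  have "0 \<le> E" using L_nonneg n_ge_1 K_nonneg C3 B by (simp add: E_def)
  then have E': "0 \<le> E'" using \<kappa> by (auto simp: E'_def)
  have U: "0 \<le> U" using u_le[OF t, of y] u_nonneg[OF t, of y] by simp
  have LT: "0 \<le> LT" using order_trans[OF norm_ge_zero Dx_terminal] .
  define S where "S = U / R + LT"
  have S: "0 \<le> S" "LT \<le> S" using U LT R by (auto simp: S_def)
  have bdry: "(1 - K * R) * u (x, t) - u (y, t) \<le> S * R" if t: "t \<in> {0..T}" for x y t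
  proof -
    have "(1 - K * R) * u (x, t) \<le> u (x, t)"
      using R K_nonneg u_nonneg[OF t] by (intro mult_left_le_one_le) auto
    also have "\<dots> \<le> U" by (rule u_le[OF t])
    also have "U \<le> S * R" using R LT by (simp add: S_def field_simps)
    finally show ?thesis using u_nonneg[OF t, of y] by simp
  qed
  have "norm (Dx u (y, t)) \<le> K * U + (S + E' * R powr \<tau>)"
  proof (rule gradient_le[OF t _ R(1)])
    show "0 \<le> K * U + (S + E' * R powr \<tau>)" using K_nonneg U S E' by simp
    fix k x assume xy: "norm (x - y) = R / 2 ^ k"
    let ?r = "R / 2 ^ k"
    have r: "0 < ?r" using R by simp
    have "(1 - K * ?r) * u (x, t) - u (y, t) \<le> (S + E' * (R powr \<tau> - ?r powr \<tau>)) * ?r"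
      unfolding E'_def by (rule slope_at_scale[OF R S bdry t xy])
    also have "\<dots> \<le> (S + E' * R powr \<tau>) * ?r"
      using r E' by (intro mult_right_mono add_left_mono mult_left_mono) auto
    finally have "u (x, t) - u (y, t) \<le> K * ?r * u (x, t) + (S + E' * R powr \<tau>) * ?r"
      by (simp add: algebra_simps)
    also have "K * ?r * u (x, t) \<le> K * ?r * U"
      using K_nonneg r by (intro mult_left_mono u_le[OF t] mult_nonneg_nonneg less_imp_le[OF r])
    finally show "u (x, t) - u (y, t) \<le> (K * U + (S + E' * R powr \<tau>)) * ?r"
      by (simp add: algebra_simps)
  qed
  then show ?thesis by (simp add: S_def E'_def algebra_simps)
qed

end

subsection \<open>The gradient bound\<close>

lemma periodic_x_bounded:
  fixes g :: "(real^'d::finite) \<times> real \<Rightarrow> 'b::real_normed_vector"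
  assumes "continuous_on UNIV g" "periodic_x g"
  obtains b where "\<And>x t. t \<in> {0..T} \<Longrightarrow> norm (g (x, t)) \<le> b"
proof -
  have "compact (g ` (cbox 0 One \<times> {0..T}))"
    by (rule compact_continuous_image[OF continuous_on_subset[OF assms(1) subset_UNIV]])
      (intro compact_Times compact_cbox compact_Icc)
  then have "bounded (g ` (cbox 0 One \<times> {0..T}))" by (rule compact_imp_bounded)
  then obtain b where "\<forall>y \<in> g ` (cbox 0 One \<times> {0..T}). norm y \<le> b" unfolding bounded_iff ..
  then have b: "norm (g z) \<le> b" if "z \<in> cbox 0 One \<times> {0..T}" for z using that by blast
  have "norm (g (x, t)) \<le> b" if "t \<in> {0..T}" for x t
    using b[of "(x - floor_vec x, t)"] that diff_floor_vec_in_cube[of x]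
      periodic_fun_floor_vec[of "\<lambda>x. g (x, t)" x x] assms(2)
    by (simp add: periodic_x_def)
  then show ?thesis using that by blast
qed

lemma periodic_x_dirderiv: "periodic_x u \<Longrightarrow> periodic_x (dirderiv v u)"
proof -
  assume per: "periodic_x u"
  have "u ((x + axis i 1, t) + h *\<^sub>R v) = u ((x, t) + h *\<^sub>R v)" for x i t h
  proof -
    have "u ((x + axis i 1, t) + h *\<^sub>R v) = u ((x + h *\<^sub>R fst v) + axis i 1, t + h * snd v)"
      by (cases v) (simp add: add_ac)
    also have "\<dots> = u (x + h *\<^sub>R fst v, t + h * snd v)"
      using per by (simp add: periodic_x_def periodic_fun_def)
    finally show ?thesis by (cases v) simp
  qed
  then show ?thesis by (simp add: periodic_x_def periodic_fun_def dirderiv_def)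
qed

lemma periodic_x_Dx: "periodic_x u \<Longrightarrow> periodic_x (Dx u)"
  using periodic_x_dirderiv[of u] by (simp add: periodic_x_def periodic_fun_def Dx_def)

lemma periodic_x_Dt: "periodic_x u \<Longrightarrow> periodic_x (Dt u)"
  using periodic_x_dirderiv[of u] by (simp add: periodic_x_def periodic_fun_def Dt_def)

lemma periodic_x_Lap: "periodic_x u \<Longrightarrow> periodic_x (Lap u)"
  using periodic_x_dirderiv[OF periodic_x_dirderiv[of u]] by (simp add: periodic_x_def periodic_fun_def Lap_def)

text \<open>A supremum of reals dominates its elements once the set is bounded above; the auxiliary
  \<open>b\<close> guarantees this.\<close>

lemma norm_le_Linf_norm_vec:
  assumes "\<And>x t. t \<in> {0..T} \<Longrightarrow> norm (F (x, t)) \<le> b" "t \<in> {0..T}"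
  shows "norm (F (x, t)) \<le> Linf_norm_vec T F"
  unfolding Linf_norm_vec_def
  by (rule cSUP_upper) (use assms in \<open>auto intro!: bdd_aboveI[of _ b]\<close>)

lemma Linf_norm_vec_le:
  assumes "\<And>x t. t \<in> {0..T} \<Longrightarrow> norm (F (x, t)) \<le> b" "0 \<le> T"
  shows "Linf_norm_vec T F \<le> b"
  unfolding Linf_norm_vec_def
  by (rule cSUP_least) (use assms in auto)

lemma abs_le_Linf_norm:
  assumes "\<And>x t. t \<in> {0..T} \<Longrightarrow> \<bar>F (x, t)\<bar> \<le> b" "t \<in> {0..T}"
  shows "\<bar>F (x, t)\<bar> \<le> Linf_norm T F"
  unfolding Linf_norm_def
  by (rule cSUP_upper) (use assms in \<open>auto intro!: bdd_aboveI[of _ b]\<close>)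

lemma integral_powr_le_Linf_Lp_norm:
  fixes f :: "(real^'d::finite) \<times> real \<Rightarrow> real"
  assumes cont: "\<And>t. t \<in> {0..T} \<Longrightarrow> continuous_on UNIV (\<lambda>x. f (x, t))"
    and bound: "\<And>x t. t \<in> {0..T} \<Longrightarrow> \<bar>f (x, t)\<bar> \<le> b" and p: "0 < p" and t: "t \<in> {0..T}"
  shows "0 \<le> Linf_Lp_norm T p f"
    and "integral (cbox 0 One) (\<lambda>x. \<bar>f (x, t)\<bar> powr p) \<le> Linf_Lp_norm T p f powr p"
proof -
  let ?C = "cbox 0 (One::real^'d)"
  let ?I = "\<lambda>t. integral ?C (\<lambda>x. \<bar>f (x, t)\<bar> powr p)"
  have int: "((\<lambda>x. \<bar>f (x, t)\<bar> powr p) has_integral ?I t) ?C" if "t \<in> {0..T}" for t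
    using p by (intro integrable_integral integrable_continuous continuous_on_powr' continuous_on_rabs
        continuous_on_subset[OF cont[OF that]] continuous_on_const) auto
  have I_nonneg: "0 \<le> ?I t" if "t \<in> {0..T}" for t
    by (rule has_integral_nonneg[OF int[OF that]]) simp
  have "?I t \<le> b powr p" if "t \<in> {0..T}" for t
  proof (rule has_integral_le[OF int[OF that]])
    show "((\<lambda>x. b powr p) has_integral b powr p) ?C"
      using has_integral_const[of "b powr p" 0 "One::real^'d"] by simp
    show "\<bar>f (x, t)\<bar> powr p \<le> b powr p" for x
      using bound[OF that] p by (intro powr_mono2) auto
  qed
  then have "?I s powr (1 / p) \<le> (b powr p) powr (1 / p)" if "s \<in> {0..T}" for s
    using that p I_nonneg by (intro powr_mono2) auto
  then have "bdd_above ((\<lambda>t. ?I t powr (1 / p)) ` {0..T})"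
    by (intro bdd_aboveI2)
  then have le: "?I t powr (1 / p) \<le> Linf_Lp_norm T p f"
    unfolding Linf_Lp_norm_def by (rule cSUP_upper[OF t])
  then show "0 \<le> Linf_Lp_norm T p f" using order_trans[OF powr_ge_zero] by blast
  have "(?I t powr (1 / p)) powr p \<le> Linf_Lp_norm T p f powr p"
    using le p by (intro powr_mono2) auto
  then show "?I t \<le> Linf_Lp_norm T p f powr p"
    using p I_nonneg[OF t] by (simp add: powr_powr)
qed

text \<open>In the non-integrable case the integral is 0 by convention, so the sign is preserved
  there too.\<close>

lemma moll_nonneg:
  assumes "\<And>y. 0 \<le> \<eta> y" "0 < \<epsilon>" "\<And>x. 0 \<le> f x"
  shows "0 \<le> moll \<eta> \<epsilon> f x"
proof (cases "(\<lambda>y. scaled_kernel \<eta> \<epsilon> y * f (x - y)) integrable_on UNIV")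
  case True
  then show ?thesis unfolding moll_def by (rule integral_nonneg) (use assms in \<open>simp add: scaled_kernel_def\<close>)
qed (simp add: moll_def not_integrable_integral)

text \<open>\<open>R\<close> is fixed, independently of \<open>u\<close> and \<open>f\<close>, so
  small that the error proportional to \<open>L\<close> is at most \<open>L / 2\<close>. The
  constant \<open>A\<close> is therefore uniform over all solutions with the given data.\<close>

lemma hamilton_jacobi_gradient_bound:
  fixes H :: "real^'d::finite \<Rightarrow> real^'d \<Rightarrow> real"
  assumes T: "0 < T" and smooth_H: "smooth_fun (Hfun H)" and convex_H: "\<And>x. strictly_convex (H x)"
    and H_ge_1: "\<And>x q. 1 \<le> H x q" and per_H: "\<And>q. periodic_fun (\<lambda>x. H x q)"
    and uT: "smooth_fun uT" "periodic_fun uT"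
    and c: "0 < c" and C3: "0 \<le> C3" and Lhat: "\<And>x q. c * H x q - C3 \<le> DpH H x q \<bullet> q - H x q"
    and DxH_le: "\<And>x q. norm (DxH H x q) \<le> C5 * H x q + C5"
    and p: "real CARD('d) < p"
  shows "\<exists>A\<ge>0. \<forall>u f. smooth_fun u \<longrightarrow> periodic_x u \<longrightarrow> (\<forall>x. u (x, T) = uT x) \<longrightarrow>
      (\<forall>x. \<forall>t\<in>{0..T}. 0 \<le> f (x, t)) \<longrightarrow>
      (\<forall>x. \<forall>t\<in>{0..T}. - Dt u (x, t) + H x (Dx u (x, t)) = Lap u (x, t) + f (x, t)) \<longrightarrow>
      0 \<le> Linf_norm_vec T (Dx u) \<and> 0 \<le> Linf_norm T u \<and> 0 \<le> Linf_Lp_norm T p f \<and>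
      Linf_norm_vec T (Dx u) \<le> A * (1 + Linf_norm T u + Linf_Lp_norm T p f)"
proof -
  have C5: "0 \<le> C5"
  proof (rule ccontr)
    assume "\<not> 0 \<le> C5"
    then have "C5 * H 0 0 + C5 < 0" using H_ge_1[of 0 0] by (smt (verit) mult_neg_pos)
    then show False using DxH_le[of 0 0] norm_ge_zero[of "DxH H 0 0"] by linarith
  qed
  define n where "n = real CARD('d)"
  define K where "K = 2 * C5 * (1 + n) / c"
  define \<tau> where "\<tau> = (1 - n / p) / (1 + n / p)"
  define \<kappa> where "\<kappa> = 1 - 2 powr (- \<tau>)"
  have n: "1 \<le> n" by (simp add: n_def Suc_leI)
  have "0 < n / p" "n / p < 1" using p n by (auto simp: n_def)
  then have \<tau>: "0 < \<tau>" unfolding \<tau>_def by (intro divide_pos_pos) auto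
  have \<kappa>: "0 < \<kappa>" using \<tau> by (simp add: \<kappa>_def powr_less_one)
  have K: "0 \<le> K" using C5 c n by (simp add: K_def)
  \<comment> \<open>Makes \<open>4 * (n + 1 + K) / \<kappa> * \<theta>\<close> equal to one
    half.\<close>
  define \<theta> where "\<theta> = \<kappa> / (8 * (n + 1 + K))"
  have \<theta>: "0 < \<theta>" using \<kappa> n K by (simp add: \<theta>_def)
  \<comment> \<open>The first entry gives \<open>R \<le> 1\<close> and \<open>K * R < 1\<close>, the
    second \<open>R powr \<tau> \<le> \<theta>\<close>.\<close>
  define R where "R = min (1 / (2 * (K + 1))) (\<theta> powr (1 / \<tau>))"
  have R: "0 < R" "R \<le> 1 / (2 * (K + 1))" "R \<le> \<theta> powr (1 / \<tau>)" using K \<theta> by (auto simp: R_def)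
  have R1: "R \<le> 1" using order_trans[OF R(2)] K by simp
  have "K * R \<le> K * (1 / (2 * (K + 1)))" using R K by (intro mult_left_mono)
  also have "\<dots> < 1" using K by (simp add: field_simps)
  finally have KR: "K * R < 1" .
  have "R powr \<tau> \<le> (\<theta> powr (1 / \<tau>)) powr \<tau>" using R \<tau> by (intro powr_mono2) auto
  then have R\<tau>: "R powr \<tau> \<le> \<theta>" using \<tau> \<theta> by (simp add: powr_powr)
  have R\<tau>1: "R powr \<tau> \<le> 1" using R R1 \<tau> by (intro powr_le1) auto

  \<comment> \<open>The terminal gradient as a function on space-time, constant in time, so that
    \<open>periodic_x_bounded\<close> applies.\<close>
  define DuT where "DuT z = (\<chi> i. dirderiv (axis i 1) uT (fst z))" for z :: "(real^'d) \<times> real"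
  have "continuous_on UNIV DuT"
    unfolding DuT_def
    by (intro continuous_on_vec_lambda continuous_on_compose2[OF smooth_fun_continuous[OF smooth_fun_dirderiv[OF uT(1)], of _ UNIV]]
      continuous_intros) auto
  moreover have "periodic_x DuT"
  proof -
    have "uT (x + axis i 1 + w) = uT (x + w)" for x w i
      using uT(2)[unfolded periodic_fun_def, rule_format, of "x + w" i] by (simp add: add_ac)
    then show ?thesis by (simp add: periodic_x_def periodic_fun_def DuT_def dirderiv_def)
  qed
  ultimately obtain LT where LT: "\<And>x. norm (DuT (x, 0)) \<le> LT"
    using periodic_x_bounded[of DuT 0] by auto
  have LT0: "0 \<le> LT" using order_trans[OF norm_ge_zero LT] .

  \<comment> \<open>The coefficients are doubled by moving \<open>L / 2\<close> to the left; the one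
    of \<open>N\<close> is doubled once more because the shifted solution is bounded by
    \<open>2 * N\<close>.\<close>
  define A where "A = 4 * (K + 1 / R) + 2 * LT + 2 * (C3 + 1 + 2 ^ CARD('d)) / \<kappa>"
  have "0 \<le> A" using K R LT0 C3 \<kappa> by (simp add: A_def)
  moreover have "0 \<le> Linf_norm_vec T (Dx u) \<and> 0 \<le> Linf_norm T u \<and> 0 \<le> Linf_Lp_norm T p f \<and>
      Linf_norm_vec T (Dx u) \<le> A * (1 + Linf_norm T u + Linf_Lp_norm T p f)"
    if u: "smooth_fun u" and per: "periodic_x u" and terminal: "\<forall>x. u (x, T) = uT x"
      and f0: "\<forall>x. \<forall>t\<in>{0..T}. 0 \<le> f (x, t)"
      and eq: "\<forall>x. \<forall>t\<in>{0..T}. - Dt u (x, t) + H x (Dx u (x, t)) = Lap u (x, t) + f (x, t)" for u f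
  proof -
    define L where "L = Linf_norm_vec T (Dx u)"
    define N where "N = Linf_norm T u"
    define F where "F = Linf_Lp_norm T p f"
    obtain bu where "\<And>x t. t \<in> {0..T} \<Longrightarrow> norm (u (x, t)) \<le> bu"
      using periodic_x_bounded[OF smooth_fun_continuous[OF u] per] by blast
    then have uN: "\<bar>u (x, t)\<bar> \<le> N" if "t \<in> {0..T}" for x t
      unfolding N_def using that by (intro abs_le_Linf_norm[of T u bu]) auto
    obtain bD where "\<And>x t. t \<in> {0..T} \<Longrightarrow> norm (Dx u (x, t)) \<le> bD"
      using periodic_x_bounded[OF smooth_fun_continuous_Dx[OF u] periodic_x_Dx[OF per]] by blast
    then have DL: "norm (Dx u (x, t)) \<le> L" if "t \<in> {0..T}" for x t
      unfolding L_def using that by (intro norm_le_Linf_norm_vec[of T "Dx u" bD]) auto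
    have L0: "0 \<le> L" and N0: "0 \<le> N"
      using DL[of 0 0] uN[of 0 0] T by (auto intro: order_trans[OF norm_ge_zero] order_trans[OF abs_ge_zero])

    \<comment> \<open>Nothing is known about \<open>f\<close> outside \<open>{0..T}\<close>. The
      equation defines a continuous periodic \<open>h\<close> at all times that agrees with
      \<open>f\<close> there and supplies continuity, periodicity and boundedness.\<close>
    define h where "h z = - Dt u z + Hfun H (fst z, Dx u z) - Lap u z" for z
    have fh: "f (x, t) = h (x, t)" if "t \<in> {0..T}" for x t
      using bspec[OF spec[OF eq, of x] that] by (simp add: h_def Hfun_def)
    have h_cont: "continuous_on UNIV h"
      unfolding h_def
      by (intro continuous_intros smooth_fun_continuous_Dt smooth_fun_continuous_Dx smooth_fun_continuous_Lap u
        continuous_on_compose2[OF smooth_fun_continuous[OF smooth_H, of UNIV]]) auto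
    have h_per: "periodic_x h"
      using periodic_x_Dx[OF per] periodic_x_Dt[OF per] periodic_x_Lap[OF per] per_H
      by (simp add: periodic_x_def periodic_fun_def h_def Hfun_def)
    obtain bh where "\<And>x t. t \<in> {0..T} \<Longrightarrow> norm (h (x, t)) \<le> bh"
      using periodic_x_bounded[OF h_cont h_per] by blast
    then have f_bound: "\<bar>f (x, t)\<bar> \<le> bh" if "t \<in> {0..T}" for x t
      using that fh by simp
    have f_cont: "continuous_on UNIV (\<lambda>x. f (x, t))" if "t \<in> {0..T}" for t
      using fh[OF that] by (simp add: continuous_on_compose2[OF h_cont] continuous_intros)
    have p0: "0 < p" using p n by (simp add: n_def)
    have F0: "0 \<le> F"
      unfolding F_def by (rule integral_powr_le_Linf_Lp_norm(1)[OF f_cont f_bound p0, of T 0]) (use T in auto)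
    \<comment> \<open>\<open>F + 1\<close> replaces \<open>F\<close> because the locale asks for a
      strictly positive bound.\<close>
    have fF: "integral (cbox 0 One) (\<lambda>x. f (x, t) powr p) \<le> (F + 1) powr p" if "t \<in> {0..T}" for t
    proof -
      have "integral (cbox 0 One) (\<lambda>x. f (x, t) powr p) = integral (cbox 0 One) (\<lambda>x. \<bar>f (x, t)\<bar> powr p)"
        using f0 that by simp
      also have "\<dots> \<le> F powr p"
        unfolding F_def by (rule integral_powr_le_Linf_Lp_norm(2)[OF f_cont f_bound p0 that])
      also have "\<dots> \<le> (F + 1) powr p" using F0 p0 by (intro powr_mono2) auto
      finally show ?thesis .
    qed
    \<comment> \<open>The shift gives values between 0 and \<open>2 * N\<close> and changes no
      derivative.\<close>
    define v where "v z = u z + N" for z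
    have Dv: "Dx v = Dx u" "Dt v = Dt u" "Lap v = Lap u"
      by (auto simp: v_def[abs_def] Dx_def Dt_def Lap_def dirderiv_add_const)
    have "Dx u (x, T) = DuT (x, 0)" for x
      using terminal by (simp add: Dx_def DuT_def dirderiv_def vec_eq_iff)
    then have DT: "norm (Dx u (x, T)) \<le> LT" for x using LT by simp
    interpret hj: hamilton_jacobi H v f T c C3 C5 L LT "F + 1" p
    proof
      show "smooth_fun v" unfolding v_def[abs_def] by (rule smooth_fun_add_const[OF u])
      show "periodic_x v" using per by (simp add: periodic_x_def periodic_fun_def v_def)
      show "periodic_fun (\<lambda>x. f (x, t))" if "t \<in> {0..T}" for t
        using h_per fh[OF that] by (simp add: periodic_x_def periodic_fun_def)
      show "0 \<le> v (x, t)" if "t \<in> {0..T}" for x t using uN[OF that, of x] by (simp add: v_def)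
    qed (use smooth_H convex_H H_ge_1 C5 DxH_le c C3 Lhat eq f0 DL T DT p F0 fF in \<open>auto simp: Dv\<close>)
    have [simp]: "hj.n = n" "hj.K = K" "hj.\<tau> = \<tau>"
      by (simp_all add: hj.n_def hj.K_def hj.\<tau>_def n_def K_def \<tau>_def)
    have E: "hj.E = 4 * (n + 1 + K) * L + (C3 + 1 + 2 ^ CARD('d) * (F + 1))"
      by (simp add: hj.E_def algebra_simps)
    have "v (x, t) \<le> 2 * N" if "t \<in> {0..T}" for x t
      using uN[OF that, of x] by (simp add: v_def)
    then have "norm (Dx u (y, t)) \<le> (K + 1 / R) * (2 * N) + LT + hj.E / \<kappa> * R powr \<tau>" if "t \<in> {0..T}" for y t
      using hj.gradient_estimate[of R "2 * N" t y] R(1) R1 KR that by (simp add: Dv \<kappa>_def)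
    then have "L \<le> (K + 1 / R) * (2 * N) + LT + hj.E / \<kappa> * R powr \<tau>"
      unfolding L_def using T by (intro Linf_norm_vec_le) auto
    also have "hj.E / \<kappa> * R powr \<tau> = 4 * (n + 1 + K) * L / \<kappa> * R powr \<tau> + (C3 + 1 + 2 ^ CARD('d) * (F + 1)) / \<kappa> * R powr \<tau>"
      unfolding E by (simp add: add_divide_distrib distrib_right)
    also have "4 * (n + 1 + K) * L / \<kappa> * R powr \<tau> \<le> 4 * (n + 1 + K) * L / \<kappa> * \<theta>"
      using n K L0 \<kappa> R\<tau> by (intro mult_left_mono) auto
    also have "\<dots> = L / 2"
    proof -
      have *: "4 * k * L / \<kappa> * (\<kappa> / (8 * k)) = L / 2" if "k \<noteq> 0" for k
        using that \<kappa> by simp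
      show ?thesis unfolding \<theta>_def by (rule *) (use n K in simp)
    qed
    also have "(C3 + 1 + 2 ^ CARD('d) * (F + 1)) / \<kappa> * R powr \<tau> \<le> (C3 + 1 + 2 ^ CARD('d) * (F + 1)) / \<kappa>"
      using C3 F0 \<kappa> R\<tau>1 by (intro mult_right_le_one_le) auto
    also have "\<dots> \<le> (C3 + 1 + 2 ^ CARD('d)) * (1 + F) / \<kappa>"
      using C3 F0 \<kappa> by (intro divide_right_mono) (auto simp: algebra_simps)
    finally have "L \<le> (K + 1 / R) * (2 * N) + LT + (L / 2 + (C3 + 1 + 2 ^ CARD('d)) * (1 + F) / \<kappa>)"
      by simp
    then have "L \<le> 2 * ((K + 1 / R) * (2 * N)) + 2 * LT + 2 * ((C3 + 1 + 2 ^ CARD('d)) * (1 + F) / \<kappa>)"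
      by linarith
    also have "\<dots> = 4 * (K + 1 / R) * N + 2 * LT + 2 * (C3 + 1 + 2 ^ CARD('d)) / \<kappa> * (1 + F)"
    proof -
      have *: "2 * (k * (2 * N)) + l + 2 * (q * (1 + F) / \<kappa>) = 4 * k * N + l + 2 * q / \<kappa> * (1 + F)" for k l q
        by simp
      show ?thesis by (rule *)
    qed
    also have "\<dots> \<le> 4 * (K + 1 / R) * (1 + N + F) + 2 * LT * (1 + N + F)
        + 2 * (C3 + 1 + 2 ^ CARD('d)) / \<kappa> * (1 + N + F)"
    proof -
      have "2 * LT * 1 \<le> 2 * LT * (1 + N + F)" using LT0 N0 F0 by (intro mult_left_mono) auto
      then show ?thesis
        using K R N0 F0 C3 \<kappa> by (intro add_mono mult_left_mono) auto
    qed
    also have "\<dots> = A * (1 + N + F)" by (simp add: A_def distrib_right)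
    finally show ?thesis using L0 N0 F0 by (simp add: L_def N_def F_def)
  qed
  ultimately show ?thesis by blast
qed

text \<open>The constant is obtained from the data before \<open>\<epsilon>\<close>,
  \<open>u\<close> and \<open>m\<close> are introduced, which is the asserted independence of
  \<open>\<epsilon>\<close>.\<close>

theorem theorem6:
  fixes H :: "real^'d::finite \<Rightarrow> real^'d \<Rightarrow> real"
    and uT m0 \<eta> :: "real^'d \<Rightarrow> real"
    and T \<alpha> \<mu> \<kappa>0 p :: real
  assumes T_pos: "0 < T"
    \<comment> \<open>(A1)\<close>
    and A1_smooth: "smooth_fun (Hfun H)"
    and A1_convex: "\<forall>x. strictly_convex (H x)"
    and A1_superlinear: "\<forall>x. filterlim (\<lambda>q. H x q / norm q) at_top at_infinity"
    and A1_ge1: "\<forall>x q. 1 \<le> H x q"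
    and H_periodic: "\<forall>q. periodic_fun (\<lambda>x. H x q)"
    \<comment> \<open>(A2) and (A4): g(z) = z^alpha\<close>
    and A4: "0 < \<alpha>"
    and A2_uT: "smooth_fun uT" "periodic_fun uT"
    and A2_m0: "smooth_fun m0" "periodic_fun m0" "\<forall>x. 0 \<le> m0 x"
      "integral (cbox 0 One) m0 = 1"
    \<comment> \<open>(A3)\<close>
    and A3: "\<exists>c C. 0 < c \<and> 0 < C \<and>
              (\<forall>x q. DpH H x q \<bullet> q - H x q \<ge> c * H x q - C)"
    \<comment> \<open>(A5)\<close>
    and A5a: "\<exists>C. \<forall>x q. norm (DxH H x q) \<le> C * H x q + C \<and> norm (DxxH H x q) \<le> C * H x q + C"
    and A5b: "\<forall>\<delta>>0. \<exists>C\<delta>. \<forall>M x q. symmetric_mat M \<longrightarrow>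
               trace (DpxH H x q ** M) \<le> \<delta> * trace (DppH H x q ** (M ** M)) + C\<delta> * H x q"
    \<comment> \<open>(A6)\<close>
    and A6: "0 < \<kappa>0" "\<forall>x. \<kappa>0 \<le> m0 x"
    \<comment> \<open>(A7)\<close>
    and A7_mu: "0 < \<mu>" "\<mu> < 1"
    and A7: "\<exists>c1 C1 c2 C2. 0 \<le> c1 \<and> 0 \<le> C1 \<and> 0 \<le> c2 \<and> 0 \<le> C2 \<and>
              (\<forall>x q. c1 * norm q powr (2 + \<mu>) + C1 \<le> H x q \<and>
                     H x q \<le> c2 * norm q powr (2 + \<mu>) + C2)"
    \<comment> \<open>(A8)\<close>
    and A8: "\<exists>C. \<forall>x q. (norm (DpH H x q))\<^sup>2 \<le> C * norm q powr \<mu> * H x q + C"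
    \<comment> \<open>(A9)\<close>
    and A9: "\<exists>C. (\<forall>x q. (norm (DpxH H x q))\<^sup>2 \<le> C * H x q powr ((2 + 2 * \<mu>) / (2 + \<mu>))) \<and>
              (\<forall>M x q. symmetric_mat M \<longrightarrow>
                 (norm (DppH H x q ** M))\<^sup>2 \<le> C * H x q powr (\<mu> / (2 + \<mu>)) * trace (DppH H x q ** M ** M))"
    \<comment> \<open>mollifier and exponent p\<close>
    and eta: "mollifier \<eta>"
    and p_gt: "real CARD('d) < p"
  shows "\<exists>C. \<forall>\<epsilon>>0. \<forall>u m. reg_solution T H (\<lambda>z. z powr \<alpha>) uT m0 \<eta> \<epsilon> u m \<longrightarrow>
           Linf_norm_vec T (Dx u) \<le> C + C * Linf_norm T u
             + C * Linf_Lp_norm T p (g_eps \<eta> \<epsilon> (\<lambda>z. z powr \<alpha>) m)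
                 * Linf_norm_vec T (Dx u) powr \<mu> * (1 + Linf_norm T u)"
proof -
  obtain c C3 where c: "0 < c" "0 < C3" and Lhat: "\<And>x q. c * H x q - C3 \<le> DpH H x q \<bullet> q - H x q"
    using A3 by blast
  obtain C5 where DxH_le: "\<And>x q. norm (DxH H x q) \<le> C5 * H x q + C5"
    using A5a by blast
  obtain A where A: "0 \<le> A" and grad: "\<And>u f. smooth_fun u \<Longrightarrow> periodic_x u \<Longrightarrow> \<forall>x. u (x, T) = uT x \<Longrightarrow>
      \<forall>x. \<forall>t\<in>{0..T}. 0 \<le> f (x, t) \<Longrightarrow>
      \<forall>x. \<forall>t\<in>{0..T}. - Dt u (x, t) + H x (Dx u (x, t)) = Lap u (x, t) + f (x, t) \<Longrightarrow>
      0 \<le> Linf_norm_vec T (Dx u) \<and> 0 \<le> Linf_norm T u \<and> 0 \<le> Linf_Lp_norm T p f \<and>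
      Linf_norm_vec T (Dx u) \<le> A * (1 + Linf_norm T u + Linf_Lp_norm T p f)"
    using hamilton_jacobi_gradient_bound[OF T_pos A1_smooth _ _ _ A2_uT c(1) less_imp_le[OF c(2)] Lhat DxH_le p_gt]
      A1_convex A1_ge1 H_periodic by auto
  \<comment> \<open>The added 1 settles the case \<open>L \<le> 1\<close>, where
    \<open>L powr \<mu>\<close> has no useful lower bound.\<close>
  show ?thesis
  proof (intro exI[of _ "A + 1"] allI impI)
    fix \<epsilon> :: real and u m :: "(real^'d) \<times> real \<Rightarrow> real"
    assume \<epsilon>: "0 < \<epsilon>" and sol: "reg_solution T H (\<lambda>z. z powr \<alpha>) uT m0 \<eta> \<epsilon> u m"
    let ?f = "g_eps \<eta> \<epsilon> (\<lambda>z. z powr \<alpha>) m"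
    define L where "L = Linf_norm_vec T (Dx u)"
    define N where "N = Linf_norm T u"
    define F where "F = Linf_Lp_norm T p ?f"
    \<comment> \<open>\<open>powr\<close> is nonnegative at every real argument, and so is its
      mollification.\<close>
    have "0 \<le> ?f z" for z
      unfolding g_eps_def using eta \<epsilon> by (intro moll_nonneg) (auto simp: mollifier_def)
    then have "0 \<le> L \<and> 0 \<le> N \<and> 0 \<le> F \<and> L \<le> A * (1 + N + F)"
      unfolding L_def N_def F_def using sol by (intro grad) (auto simp: reg_solution_def)
    then have L0: "0 \<le> L" and N0: "0 \<le> N" and F0: "0 \<le> F" and L_le: "L \<le> A * (1 + N + F)" by auto
    have "L \<le> (A + 1) + (A + 1) * N + (A + 1) * F * L powr \<mu> * (1 + N)"
    proof (cases "L \<le> 1")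
      case True
      moreover have "0 \<le> (A + 1) * N" "0 \<le> (A + 1) * F * L powr \<mu> * (1 + N)"
        using A N0 F0 by simp_all
      ultimately show ?thesis using A by linarith
    next
      case False
      then have "1 \<le> L powr \<mu> * (1 + N)"
        using mult_mono[of 1 "L powr \<mu>" 1 "1 + N"] N0 A7_mu ge_one_powr_ge_zero[of L \<mu>] by simp
      then have "A * F * 1 \<le> A * F * (L powr \<mu> * (1 + N))"
        using A F0 by (intro mult_left_mono) auto
      also have "\<dots> \<le> (A + 1) * F * (L powr \<mu> * (1 + N))"
        using F0 N0 by (intro mult_right_mono) auto
      finally have "A * F \<le> (A + 1) * F * L powr \<mu> * (1 + N)" by (simp add: mult.assoc)
      moreover have "A * N \<le> (A + 1) * N" using N0 by (intro mult_right_mono) auto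
      ultimately show ?thesis using L_le by (simp only: distrib_left)
    qed
    then show "Linf_norm_vec T (Dx u) \<le> (A + 1) + (A + 1) * Linf_norm T u
      + (A + 1) * Linf_Lp_norm T p ?f * Linf_norm_vec T (Dx u) powr \<mu> * (1 + Linf_norm T u)"
      by (simp only: L_def N_def F_def)
  qed
qed

end
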